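(* Let $d\geq 1$. Let $F$ be a bounded convex subset of $\mathbb{R}^d$ with nonempty interior. For every $r\in(0,\infty)$, set $F_r:=\{x\in\mathbb{Z}^d : r^{-1}x\in F\}$. Then $\mu_{F_r,\mathsf{cop}}$ converges weakly to $\mu_{\infty,\mathsf{cop}}$ when $r$ goes to infinity.
   Context: $\Omega_{\{0,1\}}:=\{0,1\}^{\mathbb{Z}^d}$ with the product topology; probability measures on it carry the weak topology. $\mathsf{cop}\in\Omega_{\{0,1\}}$ is defined by $\mathsf{cop}(x)=1$ if $\gcd(x_1,\dots,x_d)=1$ and $\mathsf{cop}(x)=0$ otherwise. For a nonempty finite $F\subset\mathbb{Z}^d$, $\mu_{F,\mathsf{cop}}$ is the distribution of the random element $x\mapsto \mathsf{cop}(x+Y)$, where $Y$ is uniformly distributed in $F$. (Here $F_r$ is finite, and nonempty for $r$ large.) Definition of $\mu_{\infty,\mathsf{cop}}$: independently for every prime $p$, let $\mathcal{W}_p$ be a uniformly chosen coset of $p\mathbb{Z}^d$ in $\mathbb{Z}^d$ (among the $p^d$ cosets). Then $\mu_{\infty,\mathsf{cop}}$ is the distribution of the indicator function of $\mathbb{Z}^d\setminus\bigcup_p\mathcal{W}_p$, i.e. of $x\mapsto\min_p \mathbf{1}_{x\notin\mathcal{W}_p}$. *)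

theory Defs
  imports "HOL-Probability.Probability" "HOL-Computational_Algebra.Primes"
begin

text \<open>
  The lattice of dimension \<open>d\<close> is \<^typ>\<open>int ^ 'd\<close>, where \<open>d = CARD('d) \<ge> 1\<close>.  An element of the
  space of 0-1 configurations is a function \<^typ>\<open>int ^ 'd \<Rightarrow> bool\<close>, with \<^const>\<open>True\<close> for 1 and
  \<^const>\<open>False\<close> for 0.  As \<^typ>\<open>bool\<close> carries the discrete topology, the topology of the type
  \<^typ>\<open>int ^ 'd \<Rightarrow> bool\<close> is the product topology; \<^const>\<open>borel\<close> below refers to it.
\<close>

type_synonym 'd config = "int ^ 'd \<Rightarrow> bool"

definition cop :: "'d::finite config" where
  "cop x \<longleftrightarrow> Gcd (range (\<lambda>i. x $ i)) = 1"

text \<open>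
  The law of the translate of \<open>\<omega>\<close> by a uniformly distributed element of \<open>A\<close>, intended for finite
  nonempty \<open>A\<close>.  For other \<open>A\<close> the value is junk, not a probability measure.
\<close>

definition shift_measure :: "(int ^ 'd) set \<Rightarrow> 'd::finite config \<Rightarrow> 'd config measure" where
  "shift_measure A \<omega> = distr (uniform_count_measure A) borel (\<lambda>Y x. \<omega> (x + Y))"

definition lattice_cosets :: "nat \<Rightarrow> (int ^ 'd::finite) set set" where
  "lattice_cosets p = range (\<lambda>a. range (\<lambda>z. a + int p *s z))"

definition cop_limit_measure :: "'d::finite config measure" where
  "cop_limit_measure =
     distr (\<Pi>\<^sub>M p\<in>{p. prime p}. uniform_count_measure (lattice_cosets p)) borel
       (\<lambda>W x. x \<notin> (\<Union>p\<in>{p. prime p}. W p))"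

text \<open>Weak convergence of Borel probability measures along a filter, on any topological space.\<close>

definition converges_weakly ::
    "('i \<Rightarrow> 'a::topological_space measure) \<Rightarrow> 'a measure \<Rightarrow> 'i filter \<Rightarrow> bool" where
  "converges_weakly M N G \<longleftrightarrow>
     (\<forall>f :: 'a \<Rightarrow> real. continuous_on UNIV f \<longrightarrow> bounded (range f) \<longrightarrow>
        ((\<lambda>i. \<integral>\<omega>. f \<omega> \<partial>M i) \<longlongrightarrow> (\<integral>\<omega>. f \<omega> \<partial>N)) G)"

definition lattice_dilate :: "(real ^ 'd::finite) set \<Rightarrow> real \<Rightarrow> (int ^ 'd) set" where
  "lattice_dilate F r = {x. inverse r *\<^sub>R (\<chi> i. real_of_int (x $ i)) \<in> F}"

text \<open>The two kinds of measures above are indeed laws: the maps are measurable.\<close>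

lemma prob_space_uniform_count_measure:
  assumes "finite A" "A \<noteq> {}"
  shows "prob_space (uniform_count_measure A)"
proof
  have "card A > 0" using assms by (simp add: card_gt_0_iff)
  then show "emeasure (uniform_count_measure A) (space (uniform_count_measure A)) = 1"
    using assms
    by (simp add: space_uniform_count_measure emeasure_uniform_count_measure flip: ennreal_of_nat_eq_real_of_nat)
qed

lemma prob_space_shift_measure:
  assumes "finite A" "A \<noteq> {}"
  shows "prob_space (shift_measure A \<omega>)"
  unfolding shift_measure_def
  by (intro prob_space.prob_space_distr prob_space_uniform_count_measure assms)
    (simp add: measurable_cong_sets[OF sets_uniform_count_measure_count_space refl])

lemma mem_residue_range_iff:
  fixes a x :: "int ^ 'd::finite"
  shows "x \<in> range (\<lambda>z. a + int p *s z) \<longleftrightarrow> (\<forall>i. x $ i mod int p = a $ i mod int p)"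
proof
  assume "x \<in> range (\<lambda>z. a + int p *s z)"
  then show "\<forall>i. x $ i mod int p = a $ i mod int p"
    by (auto simp: vector_scalar_mult_def)
next
  assume *: "\<forall>i. x $ i mod int p = a $ i mod int p"
  have "x = a + int p *s (\<chi> i. (x $ i - a $ i) div int p)"
    using * by (auto simp: vec_eq_iff vector_scalar_mult_def mod_eq_dvd_iff)
  then show "x \<in> range (\<lambda>z. a + int p *s z)"
    by blast
qed

lemma finite_lattice_cosets:
  assumes "p > 0"
  shows "finite (lattice_cosets p :: (int ^ 'd::finite) set set)"
proof -
  define R where "R = vec_lambda ` ((UNIV :: 'd set) \<rightarrow>\<^sub>E {0..<int p})"
  have "lattice_cosets p \<subseteq> (\<lambda>a. range (\<lambda>z. a + int p *s z)) ` R"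
  proof
    fix C :: "(int ^ 'd) set"
    assume "C \<in> lattice_cosets p"
    then obtain a where C: "C = range (\<lambda>z. a + int p *s z)"
      by (auto simp: lattice_cosets_def)
    let ?b = "\<chi> i. a $ i mod int p"
    have "C = range (\<lambda>z. ?b + int p *s z)"
      unfolding C by (intro set_eqI) (simp only: mem_residue_range_iff, simp)
    moreover have "?b \<in> R"
      unfolding R_def using assms by (intro imageI) auto
    ultimately show "C \<in> (\<lambda>a. range (\<lambda>z. a + int p *s z)) ` R"
      by blast
  qed
  moreover have "finite R"
    unfolding R_def by (intro finite_imageI finite_PiE) auto
  ultimately show ?thesis
    by (meson finite_imageI finite_subset)
qed

instance bool :: second_countable_topology
proof
  have "open = generate_topology (UNIV :: bool set set)"
    by (rule ext) (simp add: discrete_topology_class.open_discrete generate_topology.Basis)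
  then show "\<exists>B :: bool set set. countable B \<and> open = generate_topology B"
    using countable_finite[OF finite] by blast
qed

lemma measurable_sieve:
  "(\<lambda>W x. x \<notin> (\<Union>p\<in>{p. prime p}. W p)) \<in>
     measurable (\<Pi>\<^sub>M p\<in>{p. prime p}. uniform_count_measure (lattice_cosets p))
       (borel :: 'd::finite config measure)"
proof -
  let ?M = "\<Pi>\<^sub>M p\<in>{p::nat. prime p}. uniform_count_measure (lattice_cosets p :: (int ^ 'd) set set)"
  have "Measurable.pred ?M (\<lambda>W. x \<notin> W p)" if "prime p" for p and x :: "int ^ 'd"
    using measurable_compose[OF measurable_component_singleton[of p "{p. prime p}"
        "\<lambda>p. uniform_count_measure (lattice_cosets p)"], of "\<lambda>C. x \<notin> C" "count_space UNIV"] that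
    by (simp add: measurable_cong_sets[OF sets_uniform_count_measure_count_space refl])
  then have "Measurable.pred ?M (\<lambda>W. x \<notin> (\<Union>p\<in>{p. prime p}. W p))" for x :: "int ^ 'd"
    by (auto intro!: pred_intros_countable pred_intros_imp')
  moreover have "sets (borel :: bool measure) = sets (count_space UNIV)"
    by (rule sets_borel_eq_count_space)
  ultimately show ?thesis
    by (intro measurable_coordinatewise_then_product)
      (simp add: measurable_cong_sets[OF refl \<open>sets (borel :: bool measure) = _\<close>])
qed

lemma prob_space_cop_limit_measure:
  "prob_space (cop_limit_measure :: 'd::finite config measure)"
  unfolding cop_limit_measure_def
proof (intro prob_space.prob_space_distr prob_space_PiM measurable_sieve
    prob_space_uniform_count_measure)
  fix p :: nat
  assume "p \<in> {p. prime p}"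
  then show "finite (lattice_cosets p :: (int ^ 'd) set set)"
    by (intro finite_lattice_cosets) (simp add: prime_gt_0_nat)
  show "lattice_cosets p \<noteq> ({} :: (int ^ 'd) set set)"
    by (simp add: lattice_cosets_def)
qed

end

theory Submission
  imports Defs "HOL-Number_Theory.Cong"
begin

text \<open>
  A continuous function on the compact space of configurations is, up to \<open>\<epsilon>\<close>, a function of
  finitely many coordinates (\<open>continuous_nearly_finitely_determined\<close>), so the configurations
  \<open>x \<mapsto> cop (x + y)\<close> need only be understood at finitely many \<open>x\<close>.

  Replace coprimality by the absence of a common prime factor in a finite set \<open>J\<close> of primes.  The
  truncated configuration seen from \<open>y\<close> depends only on \<open>y\<close> modulo \<open>N = \<Prod>J\<close>.  The lattice points of
  the dilates of \<open>F\<close> are equidistributed among the residue classes modulo \<open>N\<close>: counting them is a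
  Riemann sum for the volume of \<open>F\<close>, and the frontier of a convex set has volume 0
  (\<open>lattice_dilate_residue_count\<close>).  By the Chinese remainder theorem a uniform residue class modulo
  \<open>N\<close> is the same as independent uniform cosets of \<open>p\<int>\<^sup>d\<close> for \<open>p \<in> J\<close>
  (\<open>bij_betw_residues_cosets\<close>).  Hence the truncated averages converge to the expectation for the
  sieve by \<open>J\<close> (\<open>truncated_average_converges\<close>), and these expectations converge to the one for
  \<open>\<mu>\<^sub>\<infinity>\<close> as \<open>J\<close> exhausts the primes, by dominated convergence (\<open>sieve_truncation_converges\<close>).

  The two limits may be exchanged because truncation at \<open>m\<close> changes the value at \<open>x\<close> for only a
  small proportion of the \<open>y\<close>, uniformly in the dilation (\<open>truncation_error_small\<close>).  For
  \<open>d \<ge> 2\<close> this is a union bound, since \<open>\<Sum>p>m. 1 / p\<^sup>d\<close> tends to 0.  For \<open>d = 1\<close> that series diverges;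
  but then the integers without a prime factor up to \<open>m\<close> have density \<open>\<Prod>p\<le>m. (1 - 1 / p)\<close>, which
  tends to 0 by Euler's argument, so there is nothing left that truncation could get wrong.
\<close>

section \<open>Lattice points of a dilate in a residue class\<close>

text \<open>
  The cells are half-open, so that they partition the space and each of them contains exactly
  one point of the scaled lattice.
\<close>

definition grid_cell :: "real \<Rightarrow> int ^ 'd \<Rightarrow> (real ^ 'd::finite) set" where
  "grid_cell h z = {t. \<forall>i. \<lfloor>t $ i / h\<rfloor> = z $ i}"

lemma grid_cell_iff:
  assumes "h > 0"
  shows "t \<in> grid_cell h z \<longleftrightarrow> (\<forall>i. h * z $ i \<le> t $ i \<and> t $ i < h * (z $ i + 1))"
  using assms by (simp add: grid_cell_def floor_eq_iff field_simps)

lemma sets_grid_cell: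
  assumes "h > 0"
  shows "grid_cell h z \<in> sets borel"
proof -
  have "grid_cell h z = (\<Inter>i. {t. h * z $ i \<le> t $ i} \<inter> {t. t $ i < h * (z $ i + 1)})"
    using grid_cell_iff[OF assms] by blast
  also have "\<dots> \<in> sets borel"
    by (intro sets.countable_INT' sets.Int borel_closed borel_open closed_Collect_le
        open_Collect_less continuous_intros) auto
  finally show ?thesis .
qed

lemma emeasure_grid_cell:
  fixes z :: "int ^ 'd::finite"
  assumes "h > 0"
  shows "emeasure lborel (grid_cell h z) = ennreal (h ^ CARD('d))"
proof (rule antisym)
  define a b :: "real ^ 'd" where "a = (\<chi> i. h * z $ i)" and "b = (\<chi> i. h * (z $ i + 1))"
  have le: "\<forall>i\<in>Basis. a \<bullet> i \<le> b \<bullet> i"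
    using assms by (auto simp: a_def b_def Basis_vec_def inner_axis algebra_simps)
  have "measure lborel (cbox a b) = (\<Prod>i\<in>UNIV. b $ i - a $ i)"
    using le by (intro content_cbox_cart) (simp add: box_ne_empty)
  also have "\<dots> = h ^ CARD('d)"
    by (simp add: a_def b_def algebra_simps)
  finally have vol: "emeasure lborel (cbox a b) = ennreal (h ^ CARD('d))"
    using emeasure_lborel_cbox_finite[of a b] by (simp add: emeasure_eq_ennreal_measure)
  have "grid_cell h z \<subseteq> cbox a b"
    using assms by (fastforce simp: grid_cell_iff mem_box_cart a_def b_def intro: less_imp_le)
  from emeasure_mono[OF this, of lborel] vol
  show "emeasure lborel (grid_cell h z) \<le> ennreal (h ^ CARD('d))" by simp
  have "box a b \<subseteq> grid_cell h z"
    using assms by (fastforce simp: grid_cell_iff mem_box_cart a_def b_def intro: less_imp_le)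
  from emeasure_mono[OF this, of lborel] vol le
  show "ennreal (h ^ CARD('d)) \<le> emeasure lborel (grid_cell h z)"
    using sets_grid_cell[OF assms, of z]
    by (simp add: emeasure_lborel_cbox_eq emeasure_lborel_box_eq)
qed

lemma bij_betw_vec_lambda:
  "bij_betw vec_lambda ((UNIV :: 'd::finite set) \<rightarrow>\<^sub>E A) {z. \<forall>i. z $ i \<in> A}"
  by (rule bij_betwI[where g = vec_nth]) auto

lemma finite_vec_components_in:
  assumes "finite A"
  shows "finite {z :: 'a ^ 'd::finite. \<forall>i. z $ i \<in> A}"
  using bij_betw_finite[OF bij_betw_vec_lambda, of A] assms by (simp add: finite_PiE)

lemma card_vec_components_in:
  "card {z :: 'a ^ 'd::finite. \<forall>i. z $ i \<in> A} = card A ^ CARD('d)"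
  using bij_betw_same_card[OF bij_betw_vec_lambda[where 'd = 'd], of A] by (simp add: card_PiE)

lemma lattice_dilate_bound:
  fixes F :: "(real ^ 'd::finite) set"
  assumes "bounded F"
  obtains R where "R > 0" "\<And>r y i. r > 0 \<Longrightarrow> y \<in> lattice_dilate F r \<Longrightarrow> \<bar>real_of_int (y $ i)\<bar> \<le> R * r"
proof -
  obtain R where R: "R > 0" "\<And>x. x \<in> F \<Longrightarrow> norm x \<le> R"
    using assms by (auto simp: bounded_pos)
  have "\<bar>real_of_int (y $ i)\<bar> \<le> R * r" if "r > 0" "y \<in> lattice_dilate F r"
    for r and y :: "int ^ 'd" and i
  proof -
    have "norm (inverse r *\<^sub>R (\<chi> i. real_of_int (y $ i))) \<le> R"
      by (rule R(2)) (use that in \<open>simp add: lattice_dilate_def\<close>)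
    then have "\<bar>(inverse r *\<^sub>R (\<chi> i. real_of_int (y $ i))) $ i\<bar> \<le> R"
      using component_le_norm_cart order_trans by blast
    then show ?thesis using that(1) by (simp add: abs_mult field_simps)
  qed
  with R(1) that show thesis by blast
qed

lemma finite_lattice_dilate:
  assumes "bounded F" "r > 0"
  shows "finite (lattice_dilate F r)"
proof -
  obtain R where "\<And>y i. y \<in> lattice_dilate F r \<Longrightarrow> \<bar>real_of_int (y $ i)\<bar> \<le> R * r"
    using lattice_dilate_bound[OF assms(1)] assms(2) by metis
  then have "lattice_dilate F r \<subseteq> {z. \<forall>i. z $ i \<in> {- \<lfloor>R * r\<rfloor>..\<lfloor>R * r\<rfloor>}}"
    by (fastforce simp: le_floor_iff abs_le_iff minus_le_iff)
  then show ?thesis using finite_vec_components_in finite_subset by blast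
qed

lemma measure_interior_pos:
  fixes F :: "(real ^ 'd::finite) set"
  assumes "bounded F" "interior F \<noteq> {}"
  shows "measure lborel (interior F) > 0"
proof -
  obtain x e where e: "e > 0" "ball x e \<subseteq> interior F"
    using assms(2) open_interior open_contains_ball by (metis ex_in_conv)
  have "emeasure lborel (interior F) < \<infinity>"
    using assms(1) bounded_subset[OF _ interior_subset] by (intro emeasure_bounded_finite) auto
  then have "interior F \<in> fmeasurable lborel" by (auto intro: fmeasurableI)
  then have "measure lborel (ball x e) \<le> measure lborel (interior F)"
    using e(2) by (intro measure_mono_fmeasurable) auto
  then show ?thesis using content_ball_pos[OF e(1), of x] by linarith
qed

text \<open>
  Let \<open>q r t\<close> be the point of the grid \<open>(a + N\<int>\<^sup>d) / r\<close> that belongs to the cell of \<open>t\<close>.  The integral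
  of the indicator of \<open>q r t \<in> F\<close> over \<open>t\<close> is the number of grid points in \<open>F\<close> times the volume
  \<open>(N / r)\<^sup>d\<close> of a cell.  As \<open>r\<close> grows, \<open>q r t\<close> tends to \<open>t\<close>, so the indicator tends to that of the
  interior of \<open>F\<close> at every \<open>t\<close> off the frontier, and dominated convergence applies.
\<close>

lemma lattice_dilate_residue_count:
  fixes F :: "(real ^ 'd::finite) set" and a :: "int ^ 'd"
  assumes F: "bounded F" "negligible (frontier F)" and N: "N > 0"
  shows "((\<lambda>r. real (card {y \<in> lattice_dilate F r. \<forall>i. y $ i mod int N = a $ i mod int N})
             * (N / r) ^ CARD('d))
           \<longlongrightarrow> measure lborel (interior F)) at_top"
proof -
  define Z where "Z r = {z. a + int N *s z \<in> lattice_dilate F r}" for r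
  \<comment> \<open>For \<open>r > 0\<close> this is the indicator of \<open>q r t \<in> F\<close>.  Written as a sum over cells it is visibly
    Borel, although \<open>F\<close> need not be.\<close>
  define s where "s r t = (\<Sum>z\<in>Z r. indicator (grid_cell (N / r) z) t :: real)"
    for r and t :: "real ^ 'd"
  define q where "q r t = inverse r *\<^sub>R (\<chi> i. real_of_int (a $ i) + N * \<lfloor>t $ i / (N / r)\<rfloor>)"
    for r and t :: "real ^ 'd"
  obtain R where R: "R > 0" "\<And>r y i. r > 0 \<Longrightarrow> y \<in> lattice_dilate F r \<Longrightarrow> \<bar>real_of_int (y $ i)\<bar> \<le> R * r"
    using lattice_dilate_bound[OF F(1)] by metis
  have inj: "inj (\<lambda>z. a + int N *s z)"
    using N by (auto simp: inj_def vec_eq_iff)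
  have finZ: "finite (Z r)" if "r > 0" for r
    unfolding Z_def using finite_vimageI[OF finite_lattice_dilate[OF F(1) that] inj] by
      (simp add: vimage_def)
  have card_eq: "card {y \<in> lattice_dilate F r. \<forall>i. y $ i mod int N = a $ i mod int N} = card (Z r)"
    for r
  proof -
    have "{y \<in> lattice_dilate F r. \<forall>i. y $ i mod int N = a $ i mod int N} = (\<lambda>z. a + int N *s z) ` Z r"
      unfolding Z_def mem_residue_range_iff[of _ a N, symmetric] by auto
    then show ?thesis using card_image[OF inj_on_subset[OF inj]] by auto
  qed
  have s_eq: "s r t = indicator F (q r t)" if "r > 0" for r t
  proof -
    define z where "z = (\<chi> i. \<lfloor>t $ i / (N / r)\<rfloor>)"
    have "t \<in> grid_cell (N / r) z' \<longleftrightarrow> z' = z" for z'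
      by (auto simp: grid_cell_def z_def vec_eq_iff)
    then have "s r t = (\<Sum>z'\<in>Z r. if z' = z then 1 else 0)"
      unfolding s_def by (intro sum.cong) (auto simp: indicator_def)
    also have "\<dots> = indicator (Z r) z" using finZ[OF that] by (simp add: indicator_def)
    also have "z \<in> Z r \<longleftrightarrow> q r t \<in> F"
      by (simp add: Z_def lattice_dilate_def q_def z_def)
    then have "(indicator (Z r) z :: real) = indicator F (q r t)" by (simp add: indicator_def)
    finally show ?thesis .
  qed
  have q_near: "\<bar>q r t $ i - t $ i\<bar> \<le> (\<bar>a $ i\<bar> + N) / r" if "r > 0" for r t i
  proof -
    define u where "u = t $ i / (N / r)"
    have "u - 1 \<le> \<lfloor>u\<rfloor>" "\<lfloor>u\<rfloor> \<le> u" by linarith+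
    then have 1: "\<bar>\<lfloor>u\<rfloor> - u\<bar> \<le> 1" by linarith
    have "q r t $ i - t $ i = (a $ i + N * (\<lfloor>u\<rfloor> - u)) / r"
      using that N by (simp add: q_def u_def field_simps)
    also have "\<bar>\<dots>\<bar> \<le> (\<bar>a $ i\<bar> + N * \<bar>\<lfloor>u\<rfloor> - u\<bar>) / r"
      using that abs_triangle_ineq[of "real_of_int (a $ i)" "N * (\<lfloor>u\<rfloor> - u)"]
      by (simp add: abs_mult divide_right_mono)
    also have "\<dots> \<le> (\<bar>a $ i\<bar> + N) / r"
      using that 1 mult_left_mono[OF 1, of "real N"] by (intro divide_right_mono) auto
    finally show ?thesis .
  qed
  have q_lim: "((\<lambda>r. q r t) \<longlongrightarrow> t) at_top" for t
  proof (rule vec_tendstoI)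
    fix i
    have "((\<lambda>r. (\<bar>a $ i\<bar> + N) / r) \<longlongrightarrow> 0) at_top"
      by (intro real_tendsto_divide_at_top[OF tendsto_const] filterlim_ident)
    then have "((\<lambda>r. q r t $ i - t $ i) \<longlongrightarrow> 0) at_top"
      by (rule Lim_null_comparison[rotated])
        (use q_near in \<open>auto intro!: eventually_mono[OF eventually_gt_at_top[of 0]]\<close>)
    then show "((\<lambda>r. q r t $ i) \<longlongrightarrow> t $ i) at_top" by (simp add: LIM_zero_iff)
  qed
  have s_lim: "((\<lambda>r. s r t) \<longlongrightarrow> indicator (interior F) t) at_top" if t: "t \<notin> frontier F" for t
  proof (cases "t \<in> interior F")
    case True
    then have "\<forall>\<^sub>F r in at_top. q r t \<in> interior F"
      using q_lim[of t] topological_tendstoD by blast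
    then have "\<forall>\<^sub>F r in at_top. s r t = 1"
      using eventually_gt_at_top[of 0] by eventually_elim
        (use interior_subset in \<open>auto simp: s_eq indicator_def\<close>)
    then show ?thesis using True by (simp add: tendsto_eventually)
  next
    case False
    then have "t \<in> - closure F" using t by (simp add: frontier_def)
    then have "\<forall>\<^sub>F r in at_top. q r t \<in> - closure F"
      using q_lim[of t] topological_tendstoD open_Compl closed_closure by blast
    then have "\<forall>\<^sub>F r in at_top. s r t = 0"
      using eventually_gt_at_top[of 0] by eventually_elim
        (use closure_subset in \<open>auto simp: s_eq indicator_def\<close>)
    then show ?thesis using False by (simp add: tendsto_eventually)
  qed
  \<comment> \<open>One box that contains all \<open>t\<close> with \<open>q r t \<in> F\<close>, for every \<open>r \<ge> 1\<close>.\<close>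
  define B :: "(real ^ 'd) set" where "B = cbox (\<chi> i. - (R + \<bar>a $ i\<bar> + N)) (\<chi> i. R + \<bar>a $ i\<bar> + N)"
  have dom: "norm (s r t) \<le> indicator B t" if r: "r \<ge> 1" for r t
  proof (cases "q r t \<in> F")
    case True
    have "t \<in> B" unfolding B_def mem_box_cart
    proof (intro allI)
      fix i
      define y where "y = (\<chi> i. a $ i + int N * \<lfloor>t $ i / (N / r)\<rfloor>)"
      have y: "q r t = inverse r *\<^sub>R (\<chi> i. real_of_int (y $ i))" by (simp add: q_def y_def)
      then have "y \<in> lattice_dilate F r" using True by (simp add: lattice_dilate_def)
      then have "\<bar>real_of_int (y $ i)\<bar> \<le> R * r" using R(2) r by force
      then have 1: "\<bar>q r t $ i\<bar> \<le> R" using r unfolding y by (simp add: abs_mult field_simps)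
      have "\<bar>q r t $ i - t $ i\<bar> \<le> (\<bar>a $ i\<bar> + N) / r" using q_near r by force
      also have "\<dots> \<le> \<bar>a $ i\<bar> + N" using r mult_left_mono[OF r, of "\<bar>a $ i\<bar> + N"] by
        (simp add: field_simps)
      finally have "\<bar>t $ i\<bar> \<le> R + \<bar>a $ i\<bar> + N" using 1 by linarith
      then show "(\<chi> i. - (R + \<bar>a $ i\<bar> + N)) $ i \<le> t $ i \<and> t $ i \<le> (\<chi> i. R + \<bar>a $ i\<bar> + N) $ i"
        by (simp add: abs_le_iff)
    qed
    then show ?thesis using r by (simp add: s_eq indicator_def)
  qed (use r in \<open>simp add: s_eq\<close>)
  have "((\<lambda>r. \<integral>t. s r t \<partial>lborel) \<longlongrightarrow> (\<integral>t. indicator (interior F) t \<partial>lborel)) at_top"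
  proof (rule tendsto_at_topI_sequentially)
    fix X :: "nat \<Rightarrow> real" assume X: "filterlim X at_top sequentially"
    have "\<forall>\<^sub>F n in sequentially. X n \<ge> 1"
      using X by (simp add: filterlim_at_top)
    then obtain n0 where n0: "\<And>n. n \<ge> n0 \<Longrightarrow> X n \<ge> 1" by (auto simp: eventually_sequentially)
    have null: "AE t in lborel. t \<notin> frontier F"
    proof (rule AE_not_in)
      show "frontier F \<in> null_sets lborel"
        using F(2) by (simp add: negligible_iff_null_sets null_sets_completion_iff)
    qed
    show "(\<lambda>n. \<integral>t. s (X n) t \<partial>lborel) \<longlonglongrightarrow> (\<integral>t. indicator (interior F) t \<partial>lborel)"
    proof (rule LIMSEQ_offset[of _ n0], rule integral_dominated_convergence[where w = "indicator B"])
      show "(indicator (interior F) :: _ \<Rightarrow> real) \<in> borel_measurable lborel" by simp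
      show "s (X (n + n0)) \<in> borel_measurable lborel" for n
        unfolding s_def using n0[of "n + n0"] N
        by (intro borel_measurable_sum borel_measurable_indicator) (auto intro!: sets_grid_cell)
      show "integrable lborel (indicator B :: _ \<Rightarrow> real)"
        unfolding B_def by (intro integrable_real_indicator emeasure_lborel_cbox_finite) auto
      show "AE t in lborel. (\<lambda>n. s (X (n + n0)) t) \<longlonglongrightarrow> indicator (interior F) t"
        using null
      proof eventually_elim
        case (elim t)
        show ?case
          using filterlim_compose[OF s_lim[OF elim] X] by (rule LIMSEQ_ignore_initial_segment)
      qed
      show "AE t in lborel. norm (s (X (n + n0)) t) \<le> indicator B t" for n
        using dom n0[of "n + n0"] by auto
    qed
  qed
  then have lim: "((\<lambda>r. \<integral>t. s r t \<partial>lborel) \<longlongrightarrow> measure lborel (interior F)) at_top"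
    by simp
  have int: "(\<integral>t. s r t \<partial>lborel) = card (Z r) * (N / r) ^ CARD('d)" if "r > 0" for r
  proof -
    have h: "N / r > 0" using N that by simp
    have "(\<integral>t. s r t \<partial>lborel) = (\<Sum>z\<in>Z r. \<integral>t. indicator (grid_cell (N / r) z) t \<partial>lborel)"
      unfolding s_def
      by (intro Bochner_Integration.integral_sum integrable_real_indicator)
        (auto simp: emeasure_grid_cell[OF h] sets_grid_cell[OF h])
    also have "\<dots> = (\<Sum>z\<in>Z r. (N / r) ^ CARD('d))"
      using h by (intro sum.cong) (auto simp: measure_def emeasure_grid_cell[OF h])
    finally show ?thesis by simp
  qed
  show ?thesis
    unfolding card_eq
    by (rule Lim_transform_eventually[OF lim])
      (use int in \<open>auto intro!: eventually_mono[OF eventually_gt_at_top[of 0]]\<close>)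
qed

section \<open>Coprimality and residue classes\<close>

definition residue_box :: "nat \<Rightarrow> (int ^ 'd::finite) set" where
  "residue_box N = {a. \<forall>i. a $ i \<in> {0..<int N}}"

definition residue_coset :: "nat \<Rightarrow> int ^ 'd::finite \<Rightarrow> (int ^ 'd) set" where
  "residue_coset p a = range (\<lambda>z. a + int p *s z)"

definition sieve :: "nat set \<Rightarrow> (nat \<Rightarrow> (int ^ 'd::finite) set) \<Rightarrow> 'd config" where
  "sieve J W = (\<lambda>x. x \<notin> (\<Union>p\<in>J. W p))"

text \<open>
  The expectation of \<open>h\<close> when the cosets \<open>W p\<close>, \<open>p \<in> J\<close>, are independent and uniform.
\<close>

definition sieve_average :: "nat set \<Rightarrow> ('d::finite config \<Rightarrow> real) \<Rightarrow> real" where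
  "sieve_average J h = (\<Sum>W\<in>PiE J lattice_cosets. h (sieve J W)) /
     card (PiE J lattice_cosets :: (nat \<Rightarrow> (int ^ 'd) set) set)"

definition no_common_factor_in :: "nat set \<Rightarrow> 'd::finite config" where
  "no_common_factor_in J x \<longleftrightarrow> (\<forall>p\<in>J. \<exists>i. \<not> int p dvd x $ i)"

abbreviation primes_upto :: "nat \<Rightarrow> nat set" where
  "primes_upto n \<equiv> {p. prime p \<and> p \<le> n}"

lemma cop_eq_no_common_prime: "cop = no_common_factor_in {p. prime p}"
proof (rule ext)
  fix x :: "int ^ 'd"
  let ?g = "Gcd (range (\<lambda>i. x $ i))"
  have dvd: "int p dvd ?g \<longleftrightarrow> (\<forall>i. int p dvd x $ i)" for p
    by (auto simp: dvd_Gcd_iff)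
  have "?g = 1 \<longleftrightarrow> (\<forall>p::nat. prime p \<longrightarrow> \<not> int p dvd ?g)"
  proof
    assume *: "\<forall>p::nat. prime p \<longrightarrow> \<not> int p dvd ?g"
    have "nat ?g = 1"
    proof (rule ccontr)
      assume "nat ?g \<noteq> 1"
      then obtain p where p: "prime p" "p dvd nat ?g" using prime_factor_nat by blast
      then have "int p dvd ?g" using int_dvd_int_iff[of p "nat ?g"] by simp
      with * p(1) show False by blast
    qed
    then show "?g = 1" by (simp add: nat_eq_iff)
  qed (auto simp: prime_nat_iff)
  then show "cop x \<longleftrightarrow> no_common_factor_in {p. prime p} x"
    unfolding cop_def no_common_factor_in_def dvd by auto
qed

lemma finite_residue_box: "finite (residue_box N)"
  by (simp only: residue_box_def finite_vec_components_in finite_atLeastLessThan_int)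

lemma card_residue_box: "card (residue_box N :: (int ^ 'd::finite) set) = N ^ CARD('d)"
  by (simp only: residue_box_def card_vec_components_in) simp

lemma mem_residue_coset_iff:
  "x \<in> residue_coset p a \<longleftrightarrow> (\<forall>i. x $ i mod int p = a $ i mod int p)"
  by (simp only: residue_coset_def mem_residue_range_iff)

lemma residue_coset_eq_iff:
  "residue_coset p a = residue_coset p b \<longleftrightarrow> (\<forall>i. a $ i mod int p = b $ i mod int p)"
proof
  assume "residue_coset p a = residue_coset p b"
  then have "a \<in> residue_coset p b" using mem_residue_coset_iff[of a p a] by simp
  then show "\<forall>i. a $ i mod int p = b $ i mod int p" by (simp add: mem_residue_coset_iff)
qed (auto simp: mem_residue_coset_iff)

lemma residue_coset_in_lattice_cosets: "residue_coset p a \<in> lattice_cosets p"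
  by (simp add: residue_coset_def lattice_cosets_def)

lemma lattice_cosets_nonempty: "lattice_cosets p \<noteq> {}"
  using residue_coset_in_lattice_cosets by blast

lemma residue_box_mod:
  assumes "N > 0"
  shows "(\<chi> i. a $ i mod int N) \<in> residue_box N"
  using assms by (simp add: residue_box_def)

lemma card_lattice_cosets:
  assumes "p > 0"
  shows "card (lattice_cosets p :: (int ^ 'd::finite) set set) = p ^ CARD('d)"
proof -
  have "inj_on (residue_coset p) (residue_box p :: (int ^ 'd) set)"
    by (auto simp: inj_on_def residue_coset_eq_iff residue_box_def vec_eq_iff)
  moreover have "residue_coset p ` residue_box p = (lattice_cosets p :: (int ^ 'd) set set)"
  proof (intro equalityI subsetI)
    fix C :: "(int ^ 'd) set" assume "C \<in> lattice_cosets p"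
    then obtain a where "C = residue_coset p a" by (auto simp: lattice_cosets_def residue_coset_def)
    then have "C = residue_coset p (\<chi> i. a $ i mod int p)" by (simp add: residue_coset_eq_iff)
    then show "C \<in> residue_coset p ` residue_box p" using residue_box_mod[OF assms] by blast
  qed (auto simp: residue_coset_in_lattice_cosets)
  ultimately show ?thesis using card_image card_residue_box by metis
qed

text \<open>
  The Chinese remainder theorem in every coordinate.  It gives injectivity, and both sides have
  \<open>\<Prod>p\<in>J. p\<^sup>d\<close> elements.  The sign makes \<open>x\<close> lie in the coset of \<open>- a\<close> exactly if
  \<open>p\<close> divides \<open>x + a\<close>, so that the translate by \<open>a\<close> becomes a sieve.
\<close>

lemma bij_betw_residues_cosets:
  fixes J :: "nat set"
  assumes J: "finite J" "\<And>p. p \<in> J \<Longrightarrow> prime p"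
  shows "bij_betw (\<lambda>a. \<lambda>p\<in>J. residue_coset p (- a)) (residue_box (\<Prod>J) :: (int ^ 'd::finite) set)
           (PiE J lattice_cosets)"
proof -
  let ?f = "\<lambda>a :: int ^ 'd. \<lambda>p\<in>J. residue_coset p (- a)"
  let ?B = "residue_box (\<Prod>J) :: (int ^ 'd) set"
  have inj: "inj_on ?f ?B"
  proof (rule inj_onI)
    fix a b assume a: "a \<in> ?B" and b: "b \<in> ?B" and eq: "?f a = ?f b"
    have "a $ i = b $ i" for i
    proof -
      have "[a $ i = b $ i] (mod int p)" if "p \<in> J" for p
      proof -
        have "residue_coset p (- a) = residue_coset p (- b)"
          using fun_cong[OF eq, of p] that by simp
        then have "[- (a $ i) = - (b $ i)] (mod int p)" by (simp add: residue_coset_eq_iff cong_def)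
        then show ?thesis by (simp add: cong_minus_minus_iff)
      qed
      moreover have "coprime (int p) (int q)" if "p \<in> J" "q \<in> J" "p \<noteq> q" for p q
        using that J(2) by (simp add: primes_coprime_nat)
      ultimately have "[a $ i = b $ i] (mod (\<Prod>p\<in>J. int p))"
        by (intro cong_cong_prod_coprime) auto
      then have "[a $ i = b $ i] (mod int (\<Prod>J))" by simp
      then show ?thesis using a b by (simp add: residue_box_def cong_def del: of_nat_prod)
    qed
    then show "a = b" by (simp add: vec_eq_iff)
  qed
  have pos: "p > 0" if "p \<in> J" for p using J(2) that prime_gt_0_nat by blast
  have "card (PiE J lattice_cosets :: (nat \<Rightarrow> (int ^ 'd) set) set) = (\<Prod>p\<in>J. p ^ CARD('d))"
    using J(1) pos by (simp add: card_PiE card_lattice_cosets)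
  also have "\<dots> = card ?B" by (simp add: card_residue_box prod_power_distrib)
  also have "\<dots> = card (?f ` ?B)" using inj by (simp add: card_image)
  finally have "?f ` ?B = PiE J lattice_cosets"
    using J(1) pos
    by (intro card_subset_eq finite_PiE finite_lattice_cosets)
      (auto simp: residue_coset_in_lattice_cosets)
  with inj show ?thesis unfolding bij_betw_def by blast
qed

lemma sieve_residue_cosets:
  "sieve J (\<lambda>p\<in>J. residue_coset p (- a)) = (\<lambda>x. no_common_factor_in J (x + a))"
proof (rule ext)
  fix x
  have "x \<in> residue_coset p (- a) \<longleftrightarrow> (\<forall>i. int p dvd x $ i + a $ i)" for p
    by (simp add: mem_residue_coset_iff mod_eq_dvd_iff)
  then show "sieve J (\<lambda>p\<in>J. residue_coset p (- a)) x = no_common_factor_in J (x + a)"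
    by (simp add: sieve_def no_common_factor_in_def)
qed

lemma no_common_factor_in_mod:
  fixes x a :: "int ^ 'd::finite"
  assumes "\<And>p. p \<in> J \<Longrightarrow> int p dvd N"
  shows "no_common_factor_in J (x + (\<chi> i. a $ i mod N)) = no_common_factor_in J (x + a)"
proof -
  have "int p dvd x $ i + a $ i mod N \<longleftrightarrow> int p dvd x $ i + a $ i" if "p \<in> J" for p i
  proof -
    have "x $ i + a $ i = (x $ i + a $ i mod N) + N * (a $ i div N)"
      by (simp add: algebra_simps)
    moreover have "int p dvd N * (a $ i div N)" using assms[OF that] by simp
    ultimately show ?thesis using dvd_add_left_iff by metis
  qed
  then show ?thesis by (simp add: no_common_factor_in_def)
qed

section \<open>Averages that involve finitely many primes\<close>

lemma card_lattice_dilate_asymp: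
  fixes F :: "(real ^ 'd::finite) set"
  assumes "bounded F" "negligible (frontier F)"
  shows "((\<lambda>r. real (card (lattice_dilate F r)) / r ^ CARD('d)) \<longlongrightarrow> measure lborel (interior F)) at_top"
  using lattice_dilate_residue_count[OF assms, of 1 0] by (simp add: power_inverse divide_inverse)

text \<open>
  The limit in \<open>lattice_dilate_residue_count\<close> is the same volume for every class and every
  modulus; comparison with modulus 1 gives the proportion.
\<close>

lemma residue_equidistributed:
  fixes F :: "(real ^ 'd::finite) set" and a :: "int ^ 'd"
  assumes F: "bounded F" "negligible (frontier F)" "interior F \<noteq> {}" and N: "N > 0"
  shows "((\<lambda>r. real (card {y \<in> lattice_dilate F r. \<forall>i. y $ i mod int N = a $ i mod int N}) /
             card (lattice_dilate F r)) \<longlongrightarrow> 1 / real N ^ CARD('d)) at_top"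
proof -
  let ?V = "measure lborel (interior F)" and ?n = "CARD('d)"
  let ?c = "\<lambda>r. real (card {y \<in> lattice_dilate F r. \<forall>i. y $ i mod int N = a $ i mod int N})"
  have V: "?V \<noteq> 0"
    using measure_interior_pos[OF F(1,3)] by simp
  have "((\<lambda>r. ?c r * (N / r) ^ ?n / (card (lattice_dilate F r) / r ^ ?n) / N ^ ?n)
          \<longlongrightarrow> ?V / ?V / N ^ ?n) at_top"
    using V N by (intro tendsto_divide lattice_dilate_residue_count card_lattice_dilate_asymp F tendsto_const) auto
  moreover have "\<forall>\<^sub>F r in at_top. ?c r * (N / r) ^ ?n / (card (lattice_dilate F r) / r ^ ?n) / N ^ ?n
      = ?c r / card (lattice_dilate F r)"
    using eventually_gt_at_top[of 0]
  proof eventually_elim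
    case (elim r)
    then show ?case using N by (simp add: power_divide)
  qed
  ultimately show ?thesis using V by (simp add: Lim_transform_eventually)
qed

text \<open>
  The average over the dilate splits according to the residue class of \<open>y\<close> modulo \<open>\<Prod>J\<close>.  Each
  class receives the same limiting weight, and the classes correspond to the families of cosets.
\<close>

lemma truncated_average_converges:
  fixes F :: "(real ^ 'd::finite) set" and h :: "'d config \<Rightarrow> real"
  assumes F: "bounded F" "negligible (frontier F)" "interior F \<noteq> {}"
    and J: "finite J" "\<And>p. p \<in> J \<Longrightarrow> prime p"
  shows "((\<lambda>r. (\<Sum>y\<in>lattice_dilate F r. h (\<lambda>x. no_common_factor_in J (x + y))) / card (lattice_dilate F r))
           \<longlongrightarrow> sieve_average J h) at_top"
proof -
  define N where "N = \<Prod>J"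
  have N: "N > 0" using J prime_gt_0_nat by (auto simp: N_def intro: prod_pos)
  have dvd: "int p dvd int N" if "p \<in> J" for p
    using that J(1) by (auto simp: N_def simp del: of_nat_prod intro: dvd_prodI)
  let ?L = "lattice_dilate F" and ?B = "residue_box N :: (int ^ 'd) set"
  define g where "g a = h (\<lambda>x. no_common_factor_in J (x + a))" for a
  define red where "red y = (\<chi> i. y $ i mod int N)" for y :: "int ^ 'd"
  have red_iff: "red y = a \<longleftrightarrow> (\<forall>i. y $ i mod int N = a $ i mod int N)" if "a \<in> ?B" for a y
    using that by (auto simp: red_def residue_box_def vec_eq_iff)
  have bij: "bij_betw (\<lambda>a. \<lambda>p\<in>J. residue_coset p (- a)) ?B (PiE J lattice_cosets)"
    unfolding N_def by (rule bij_betw_residues_cosets[OF J])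
  have "(\<Sum>W\<in>PiE J lattice_cosets. h (sieve J W)) = (\<Sum>a\<in>?B. g a)"
    unfolding g_def using sum.reindex_bij_betw[OF bij, of "\<lambda>W. h (sieve J W)"]
    by (simp add: sieve_residue_cosets)
  moreover have "card (PiE J lattice_cosets :: (nat \<Rightarrow> (int ^ 'd) set) set) = N ^ CARD('d)"
    using bij_betw_same_card[OF bij] by (simp add: card_residue_box)
  ultimately have rhs: "sieve_average J h = (\<Sum>a\<in>?B. 1 / real N ^ CARD('d) * g a)"
    by (simp add: sieve_average_def sum_divide_distrib)
  have "((\<lambda>r. \<Sum>a\<in>?B. real (card {y \<in> ?L r. \<forall>i. y $ i mod int N = a $ i mod int N}) / card (?L r) * g a)
      \<longlongrightarrow> (\<Sum>a\<in>?B. 1 / real N ^ CARD('d) * g a)) at_top"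
    by (intro tendsto_sum tendsto_mult tendsto_const residue_equidistributed F N)
  moreover have "(\<Sum>a\<in>?B. real (card {y \<in> ?L r. \<forall>i. y $ i mod int N = a $ i mod int N}) / card (?L r) * g a)
      = (\<Sum>y\<in>?L r. g y) / card (?L r)" if r: "r > 0" for r
  proof -
    have fin: "finite (?L r)" using finite_lattice_dilate[OF F(1) r] .
    have "(\<Sum>y\<in>?L r. g y) = (\<Sum>a\<in>?B. \<Sum>y\<in>{y \<in> ?L r. red y = a}. g y)"
      using fin finite_residue_box residue_box_mod[OF N]
      by (intro sum.group[symmetric]) (auto simp: red_def)
    also have "\<dots> = (\<Sum>a\<in>?B. \<Sum>y\<in>{y \<in> ?L r. red y = a}. g a)"
      unfolding g_def red_def by (intro sum.cong refl)
        (auto simp: no_common_factor_in_mod[of J, OF dvd])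
    also have "\<dots> = (\<Sum>a\<in>?B. card {y \<in> ?L r. \<forall>i. y $ i mod int N = a $ i mod int N} * g a)"
      by (intro sum.cong refl) (simp add: red_iff)
    finally show ?thesis by (simp add: sum_divide_distrib)
  qed
  ultimately show ?thesis
    unfolding rhs unfolding g_def[symmetric]
    by (elim Lim_transform_eventually) (auto intro!: eventually_mono[OF eventually_gt_at_top[of 0]])
qed

section \<open>The contribution of the large primes\<close>

text \<open>
  Expanding each \<open>1 / (1 - 1 / p)\<close> as a geometric series and multiplying out gives the sum of
  \<open>1 / n\<close> over all \<open>n\<close> whose prime factors lie in \<open>P\<close>.  The induction on \<open>P\<close> does this for finite
  sums, one prime at a time, by splitting off the power of the new prime from \<open>n\<close>.
\<close>

lemma Euler_product_bound:
  fixes P A :: "nat set"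
  assumes "finite P" "\<And>p. p \<in> P \<Longrightarrow> prime p"
    and "finite A" "\<And>n. n \<in> A \<Longrightarrow> n > 0 \<and> prime_factors n \<subseteq> P"
  shows "(\<Sum>n\<in>A. 1 / real n) * (\<Prod>p\<in>P. 1 - 1 / real p) \<le> 1"
  using assms
proof (induction P arbitrary: A rule: finite_induct)
  case empty
  have "A \<subseteq> {1}"
  proof
    fix n assume "n \<in> A"
    then have "prime_factors n = {}" "n > 0" using empty.prems by auto
    then show "n \<in> {1}" by (simp add: prime_factorization_empty_iff)
  qed
  then have "A = {} \<or> A = {1}" by blast
  then show ?case by auto
next
  case (insert p P)
  have p: "prime p" using insert.prems by simp
  then have p1: "real p > 1" using prime_gt_1_nat by simp
  define k where "k n = multiplicity p n" for n
  define m where "m n = n div p ^ k n" for n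
  have nkm: "n = p ^ k n * m n" for n
    by (simp add: k_def m_def multiplicity_dvd)
  \<comment> \<open>Any bound for the exponents that occur would do.\<close>
  define K where "K = (\<Sum>n\<in>A. k n)"
  have inj: "inj_on (\<lambda>n. (k n, m n)) A"
  proof (rule inj_onI)
    fix n n' assume "(k n, m n) = (k n', m n')"
    then show "n = n'" using nkm[of n] nkm[of n'] by simp
  qed
  have sub: "(\<lambda>n. (k n, m n)) ` A \<subseteq> {..K} \<times> m ` A"
    using insert.prems(2) by (auto simp: K_def intro: member_le_sum)
  have "(\<Sum>n\<in>A. 1 / real n) = (\<Sum>n\<in>A. (1 / real p) ^ k n * (1 / real (m n)))"
  proof (intro sum.cong refl)
    fix n
    have "real n = real p ^ k n * real (m n)" by (subst nkm) simp
    then show "1 / real n = (1 / real p) ^ k n * (1 / real (m n))" by (simp add: power_divide)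
  qed
  also have "\<dots> = (\<Sum>(k, m)\<in>(\<lambda>n. (k n, m n)) ` A. (1 / real p) ^ k * (1 / real m))"
    using inj by (simp add: sum.reindex)
  also have "\<dots> \<le> (\<Sum>(k, m)\<in>{..K} \<times> m ` A. (1 / real p) ^ k * (1 / real m))"
    using insert.prems(2) by (intro sum_mono2 sub) auto
  also have "\<dots> = (\<Sum>k\<le>K. (1 / real p) ^ k) * (\<Sum>m\<in>m ` A. 1 / real m)"
    by (simp add: sum_product sum.cartesian_product)
  finally have le: "(\<Sum>n\<in>A. 1 / real n) \<le> (\<Sum>k\<le>K. (1 / real p) ^ k) * (\<Sum>m\<in>m ` A. 1 / real m)" .
  have geo: "(\<Sum>k\<le>K. (1 / real p) ^ k) * (1 - 1 / real p) \<le> 1"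
    using p1 sum_gp_basic[of "1 / real p" K] by (simp add: mult.commute)
  have IH: "(\<Sum>m\<in>m ` A. 1 / real m) * (\<Prod>p\<in>P. 1 - 1 / real p) \<le> 1"
  proof (rule insert.IH)
    fix l assume "l \<in> m ` A"
    then obtain n where n: "n \<in> A" "l = m n" by blast
    have n0: "n > 0" using n insert.prems by blast
    then have l0: "l > 0" using nkm[of n] n(2) by (metis gr0I mult_0_right not_less0)
    have "prime_factors l \<subseteq> prime_factors n"
      using n0 n(2) dvd_triv_right[of "m n" "p ^ k n"] by (intro dvd_prime_factors)
        (auto simp flip: nkm)
    moreover have "p \<notin> prime_factors l"
      using n(2) n0 multiplicity_decompose[of n p] prime_gt_1_nat[OF p]
      by (auto simp: k_def m_def dest: in_prime_factors_imp_dvd)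
    ultimately show "l > 0 \<and> prime_factors l \<subseteq> P" using l0 n(1) insert.prems(3) by blast
  qed (use insert.prems in auto)
  have nonneg: "0 \<le> (\<Prod>p\<in>P. 1 - 1 / real p)"
    by (intro prod_nonneg) (auto simp: divide_le_eq_1)
  have "(\<Sum>n\<in>A. 1 / real n) * (\<Prod>p\<in>insert p P. 1 - 1 / real p)
     = (\<Sum>n\<in>A. 1 / real n) * ((1 - 1 / real p) * (\<Prod>p\<in>P. 1 - 1 / real p))"
    using insert.hyps by simp
  also have "\<dots> \<le> ((\<Sum>k\<le>K. (1 / real p) ^ k) * (\<Sum>m\<in>m ` A. 1 / real m))
      * ((1 - 1 / real p) * (\<Prod>p\<in>P. 1 - 1 / real p))"
    using le nonneg p1 by (intro mult_right_mono) auto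
  also have "\<dots> = ((\<Sum>k\<le>K. (1 / real p) ^ k) * (1 - 1 / real p))
      * ((\<Sum>m\<in>m ` A. 1 / real m) * (\<Prod>p\<in>P. 1 - 1 / real p))"
    by (simp only: ac_simps)
  also have "\<dots> \<le> 1 * 1"
    using geo IH nonneg by (intro mult_mono) (auto intro!: mult_nonneg_nonneg sum_nonneg)
  finally show ?case by simp
qed

text \<open>
  All of \<open>1, \<dots>, n\<close> have their prime factors in \<open>primes_upto n\<close>, so the product is at most the
  inverse of a harmonic number.
\<close>

lemma Euler_product_tendsto_0:
  "(\<lambda>n. \<Prod>p\<in>primes_upto n. 1 - 1 / real p) \<longlonglongrightarrow> 0"
proof (rule tendsto_sandwich[where f = "\<lambda>_. 0" and h = "\<lambda>n. inverse (harm n)"])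
  have "(\<Prod>p\<in>primes_upto n. 1 - 1 / real p) \<le> inverse (harm n)" if "n \<ge> 1" for n
  proof -
    have "(\<Sum>k\<in>{1..n}. 1 / real k) * (\<Prod>p\<in>primes_upto n. 1 - 1 / real p) \<le> 1"
      by (intro Euler_product_bound) (auto simp: prime_factors_dvd dest: dvd_imp_le)
    moreover have "harm n = (\<Sum>k\<in>{1..n}. 1 / real k)" by (simp add: harm_def divide_inverse)
    moreover have "(harm n :: real) > 0" using that by (intro harm_pos) simp
    ultimately show ?thesis by (simp add: field_simps)
  qed
  then show "\<forall>\<^sub>F n in sequentially. (\<Prod>p\<in>primes_upto n. 1 - 1 / real p) \<le> inverse (harm n)"
    by (auto simp: eventually_sequentially)
  show "(\<lambda>n. inverse (harm n :: real)) \<longlonglongrightarrow> 0"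
    by (intro tendsto_inverse_0_at_top harm_at_top)
  show "\<forall>\<^sub>F n in sequentially. 0 \<le> (\<Prod>p\<in>primes_upto n. 1 - 1 / real p)"
    by (intro always_eventually allI prod_nonneg) (auto dest!: prime_gt_0_nat simp: field_simps)
qed auto

text \<open>
  Multiples of \<open>p\<close> in a cube correspond to the lattice points of a cube of half-side \<open>K / p\<close>.  Without
  the origin there are none unless \<open>K / p \<ge> 1\<close>, and then \<open>2 * (K / p) + 1\<close>, which bounds the number
  of points per coordinate, is at most \<open>3 * (K / p)\<close>.  Excluding the origin is thus what makes the
  bound decay like \<open>1 / p\<^sup>d\<close> for large \<open>p\<close>.
\<close>

lemma card_bounded_multiples_le:
  fixes K :: real
  assumes p: "p > 0" and K: "K > 0"
  defines "S \<equiv> {z :: int ^ 'd::finite. z \<noteq> 0 \<and> (\<forall>i. int p dvd z $ i \<and> \<bar>real_of_int (z $ i)\<bar> \<le> K)}"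
  shows "finite S" and "real (card S) \<le> (3 * K / p) ^ CARD('d)"
proof -
  define k where "k = \<lfloor>K / p\<rfloor>"
  define T where "T = {w :: int ^ 'd. \<forall>i. w $ i \<in> {- k..k}}"
  have T: "finite T" "card T = (nat (2 * k + 1)) ^ CARD('d)"
    unfolding T_def card_vec_components_in by (rule finite_vec_components_in)
      (simp_all add: algebra_simps)
  have sub: "S \<subseteq> (\<lambda>w. int p *s w) ` T"
  proof
    fix z assume z: "z \<in> S"
    define w where "w = (\<chi> i. z $ i div int p)"
    have zw: "z $ i = int p * w $ i" for i using z by (simp add: S_def w_def)
    have "\<bar>real_of_int (w $ i)\<bar> \<le> K / p" for i
    proof -
      have "\<bar>real_of_int (z $ i)\<bar> \<le> K" using z by (simp add: S_def)
      then show ?thesis using p by (simp add: zw abs_mult field_simps)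
    qed
    then have "\<bar>w $ i\<bar> \<le> k" for i by (simp add: k_def le_floor_iff)
    then have "w \<in> T" by (simp add: T_def abs_le_iff minus_le_iff)
    moreover have "z = int p *s w" using zw by (simp add: vec_eq_iff)
    ultimately show "z \<in> (\<lambda>w. int p *s w) ` T" by blast
  qed
  then show "finite S" using T(1) finite_surj by blast
  show "real (card S) \<le> (3 * K / p) ^ CARD('d)"
  proof (cases "K < p")
    case True
    have "z \<notin> S" for z
    proof
      assume z: "z \<in> S"
      then obtain i where "z $ i \<noteq> 0" by (auto simp: S_def vec_eq_iff)
      moreover have "int p dvd z $ i" "\<bar>real_of_int (z $ i)\<bar> \<le> K" using z by (auto simp: S_def)
      ultimately have "int p \<le> \<bar>z $ i\<bar>" "\<bar>real_of_int (z $ i)\<bar> \<le> K"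
        using dvd_imp_le_int[of "z $ i" "int p"] by auto
      then show False using True by linarith
    qed
    then have "S = {}" by blast
    then show ?thesis using K by simp
  next
    case False
    then have ge1: "K / p \<ge> 1" using p by simp
    then have k1: "k \<ge> 1" by (simp add: k_def le_floor_iff)
    have "real (nat (2 * k + 1)) = 2 * k + 1" using k1 by simp
    also have "\<dots> \<le> 2 * (K / p) + 1" unfolding k_def by linarith
    also have "\<dots> \<le> 3 * K / p" using ge1 by simp
    finally have *: "real (nat (2 * k + 1)) \<le> 3 * K / p" .
    have "card S \<le> card T"
      using surj_card_le[OF T(1) sub] .
    then have "real (card S) \<le> real (nat (2 * k + 1)) ^ CARD('d)" by
      (simp add: T(2) flip: of_nat_power)
    also have "\<dots> \<le> (3 * K / p) ^ CARD('d)" using * by (intro power_mono) auto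
    finally show ?thesis .
  qed
qed

text \<open>
  Compare with the telescoping sum of \<open>1 / (p - 1) - 1 / p = 1 / ((p - 1) * p)\<close>.
\<close>

lemma sum_inverse_squares_le:
  assumes "m \<ge> 1" "m \<le> n"
  shows "(\<Sum>p\<in>{m<..n}. 1 / real p ^ 2) \<le> 1 / m - 1 / n"
  using assms(2)
proof (induction n rule: dec_induct)
  case (step n)
  have "{m<..Suc n} = insert (Suc n) {m<..n}" using step.hyps by auto
  moreover have "1 / real (Suc n) ^ 2 \<le> 1 / n - 1 / Suc n"
  proof -
    have n: "real n > 0" using step.hyps assms(1) by simp
    have "1 / real (Suc n) ^ 2 \<le> 1 / (real n * real (Suc n))"
      using n by (intro divide_left_mono) (auto simp: power2_eq_square mult_right_mono)
    also have "\<dots> = 1 / n - 1 / Suc n" using n by (simp add: field_simps)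
    finally show ?thesis .
  qed
  ultimately show ?case using step.IH by simp
qed simp

text \<open>
  A union bound over the divisors \<open>p > m\<close>.  Since \<open>x + y\<close> ranges over a cube of size proportional
  to \<open>r\<close>, only finitely many \<open>p\<close> contribute, and the \<open>p\<close>-th contribution is of order \<open>(r / p)\<^sup>d\<close>.
  The hypothesis \<open>d \<ge> 2\<close> makes the sum over \<open>p\<close> of order \<open>1 / m\<close>.
\<close>

lemma card_large_common_divisor_le:
  fixes F :: "(real ^ 'd::finite) set" and x :: "int ^ 'd"
  assumes F: "bounded F" and d: "CARD('d) \<ge> 2"
  shows "\<exists>K>0. \<forall>m\<ge>1. \<forall>r\<ge>1.
      real (card {y \<in> lattice_dilate F r. x + y \<noteq> 0 \<and> (\<exists>p>m. \<forall>i. int p dvd (x + y) $ i)})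
        \<le> K * r ^ CARD('d) / real m"
proof -
  obtain R where R: "R > 0" "\<And>r y i. r > 0 \<Longrightarrow> y \<in> lattice_dilate F r \<Longrightarrow> \<bar>real_of_int (y $ i)\<bar> \<le> R * r"
    using lattice_dilate_bound[OF F] by metis
  define C where "C = R + (\<Sum>i\<in>UNIV. \<bar>real_of_int (x $ i)\<bar>)"
  have C: "C > 0" using R(1) by (auto simp: C_def intro: add_pos_nonneg sum_nonneg)
  have "real (card {y \<in> lattice_dilate F r. x + y \<noteq> 0 \<and> (\<exists>p>m. \<forall>i. int p dvd (x + y) $ i)})
          \<le> (3 * C) ^ CARD('d) * r ^ CARD('d) / m" (is "real (card ?bad) \<le> _")
    if m: "m \<ge> 1" and r: "r \<ge> 1" for m :: nat and r :: real
  proof -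
    have bound: "\<bar>real_of_int ((x + y) $ i)\<bar> \<le> C * r" if "y \<in> lattice_dilate F r" for y i
    proof -
      have "\<bar>real_of_int (x $ i)\<bar> \<le> (\<Sum>i\<in>UNIV. \<bar>real_of_int (x $ i)\<bar>)"
        by (intro member_le_sum) auto
      also have "\<dots> \<le> (\<Sum>i\<in>UNIV. \<bar>real_of_int (x $ i)\<bar>) * r"
        using mult_left_mono[OF r, of "\<Sum>i\<in>UNIV. \<bar>real_of_int (x $ i)\<bar>"] by (simp add: sum_nonneg)
      finally have "\<bar>real_of_int (x $ i)\<bar> \<le> (\<Sum>i\<in>UNIV. \<bar>real_of_int (x $ i)\<bar>) * r" .
      moreover have "\<bar>real_of_int (y $ i)\<bar> \<le> R * r" using R(2) that r by simp
      ultimately show ?thesis by (simp add: C_def algebra_simps)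
    qed
    define n where "n = max m (nat \<lfloor>C * r\<rfloor>)"
    define S where "S p = {z :: int ^ 'd. z \<noteq> 0 \<and> (\<forall>i. int p dvd z $ i \<and> \<bar>real_of_int (z $ i)\<bar> \<le> C * r)}" for p
    have Cr: "C * r > 0" using C r by simp
    have S: "finite (S p)" "real (card (S p)) \<le> (3 * (C * r)) ^ CARD('d) * (1 / real p ^ 2)"
      if "p > 0" for p
    proof -
      show "finite (S p)" unfolding S_def by (rule card_bounded_multiples_le[OF that Cr])
      have "real (card (S p)) \<le> (3 * (C * r) / p) ^ CARD('d)"
        unfolding S_def by (rule card_bounded_multiples_le[OF that Cr])
      also have "\<dots> = (3 * (C * r)) ^ CARD('d) * (1 / real p ^ CARD('d))" by (simp add: power_divide)
      also have "\<dots> \<le> (3 * (C * r)) ^ CARD('d) * (1 / real p ^ 2)"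
        using that d Cr by (intro mult_left_mono divide_left_mono power_increasing) auto
      finally show "real (card (S p)) \<le> (3 * (C * r)) ^ CARD('d) * (1 / real p ^ 2)" .
    qed
    have sub: "(\<lambda>y. x + y) ` ?bad \<subseteq> (\<Union>p\<in>{m<..n}. S p)"
    proof safe
      fix y p assume y: "y \<in> lattice_dilate F r" "x + y \<noteq> 0" and p: "p > m" "\<forall>i. int p dvd (x + y) $ i"
      obtain i where i: "(x + y) $ i \<noteq> 0" using y(2) by (auto simp: vec_eq_iff)
      have "int p dvd (x + y) $ i" using p(2) by blast
      then have "int p \<le> \<bar>(x + y) $ i\<bar>" using dvd_imp_le_int[OF i] by fastforce
      then have "real p \<le> C * r" using bound[OF y(1), of i] by linarith
      then have "p \<le> n" by (simp add: n_def le_nat_floor le_max_iff_disj)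
      then show "x + y \<in> (\<Union>p\<in>{m<..n}. S p)" using y p bound by (auto simp: S_def)
    qed
    have "card ?bad = card ((\<lambda>y. x + y) ` ?bad)" by (simp add: card_image)
    also have "\<dots> \<le> card (\<Union>p\<in>{m<..n}. S p)" using S(1) by (intro card_mono sub) auto
    also have "\<dots> \<le> (\<Sum>p\<in>{m<..n}. card (S p))" by (intro card_UN_le) simp
    finally have "real (card ?bad) \<le> (\<Sum>p\<in>{m<..n}. real (card (S p)))" by (simp flip: of_nat_sum)
    also have "\<dots> \<le> (\<Sum>p\<in>{m<..n}. (3 * (C * r)) ^ CARD('d) * (1 / real p ^ 2))"
      using S(2) by (intro sum_mono) auto
    also have "\<dots> = (3 * (C * r)) ^ CARD('d) * (\<Sum>p\<in>{m<..n}. 1 / real p ^ 2)"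
      by (simp add: sum_distrib_left)
    also have "\<dots> \<le> (3 * (C * r)) ^ CARD('d) * (1 / m)"
    proof (rule mult_left_mono)
      have "(\<Sum>p\<in>{m<..n}. 1 / real p ^ 2) \<le> 1 / m - 1 / n"
        by (intro sum_inverse_squares_le m) (simp add: n_def)
      then show "(\<Sum>p\<in>{m<..n}. 1 / real p ^ 2) \<le> 1 / m"
        by (rule order_trans) simp
    qed (use Cr in simp)
    finally show ?thesis by (simp add: power_mult_distrib)
  qed
  then show ?thesis using C by (intro exI[of _ "(3 * C) ^ CARD('d)"]) auto
qed

text \<open>
  For each \<open>p\<close> exactly one of the \<open>p\<^sup>d\<close> cosets contains \<open>x\<close>.
\<close>

lemma sieve_one_point_density:
  fixes x :: "int ^ 'd::finite"
  assumes J: "finite J" "\<And>p. p \<in> J \<Longrightarrow> prime p"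
  shows "sieve_average J (\<lambda>\<omega>. of_bool (\<omega> x)) = (\<Prod>p\<in>J. 1 - 1 / real p ^ CARD('d))"
proof -
  let ?C = "lattice_cosets :: nat \<Rightarrow> (int ^ 'd) set set"
  have pos: "p > 0" if "p \<in> J" for p using J(2) that prime_gt_0_nat by blast
  have count: "(\<Sum>C\<in>?C p. of_bool (x \<notin> C)) = real p ^ CARD('d) - 1" if "p \<in> J" for p
  proof -
    have fin: "finite (?C p)" using finite_lattice_cosets pos[OF that] by blast
    have "C = residue_coset p x" if C: "C \<in> ?C p" "x \<in> C" for C
    proof -
      obtain a where a: "C = residue_coset p a" using C(1) by
        (auto simp: lattice_cosets_def residue_coset_def)
      then show ?thesis using C(2) by (simp add: residue_coset_eq_iff mem_residue_coset_iff)
    qed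
    moreover have "x \<in> residue_coset p x" by (simp add: mem_residue_coset_iff)
    ultimately have "{C \<in> ?C p. x \<notin> C} = ?C p - {residue_coset p x}" by auto
    then have "card {C \<in> ?C p. x \<notin> C} = p ^ CARD('d) - 1"
      using fin residue_coset_in_lattice_cosets[of p x] by
        (simp add: card_lattice_cosets pos[OF that])
    moreover have "1 \<le> p ^ CARD('d)" using pos[OF that] by simp
    ultimately have "real (card {C \<in> ?C p. x \<notin> C}) = real p ^ CARD('d) - 1"
      by (simp add: of_nat_diff)
    then show ?thesis using fin by (simp add: sum_of_bool_eq Int_def)
  qed
  have "of_bool (sieve J W x) = (\<Prod>p\<in>J. of_bool (x \<notin> W p) :: real)" for W
    using J(1) by (induction J rule: finite_induct) (auto simp: sieve_def)
  then have "(\<Sum>W\<in>PiE J ?C. of_bool (sieve J W x)) = (\<Sum>W\<in>PiE J ?C. \<Prod>p\<in>J. of_bool (x \<notin> W p) :: real)"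
    by simp
  also have "\<dots> = (\<Prod>p\<in>J. \<Sum>C\<in>?C p. of_bool (x \<notin> C))"
    using J(1) finite_lattice_cosets pos by (intro prod_sum_PiE[symmetric]) auto
  also have "\<dots> = (\<Prod>p\<in>J. real p ^ CARD('d) - 1)" using count by simp
  finally have "sieve_average J (\<lambda>\<omega>. of_bool (\<omega> x))
      = (\<Prod>p\<in>J. real p ^ CARD('d) - 1) / (\<Prod>p\<in>J. real p ^ CARD('d))"
    using J(1) pos by (simp add: sieve_average_def card_PiE card_lattice_cosets)
  also have "\<dots> = (\<Prod>p\<in>J. (real p ^ CARD('d) - 1) / real p ^ CARD('d))" by (simp add: prod_dividef)
  also have "\<dots> = (\<Prod>p\<in>J. 1 - 1 / real p ^ CARD('d))"
    using pos by (intro prod.cong refl) (simp add: diff_divide_distrib)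
  finally show ?thesis .
qed

text \<open>
  The two cases call for different reasons.  If \<open>d = 1\<close>, already the points \<open>x + y\<close> that survive the
  truncated sieve are rare.  If \<open>d \<ge> 2\<close>, the survivors have positive density, but those among them
  that are not coprime have a common prime factor above \<open>m\<close>.
\<close>

lemma truncation_error_small:
  fixes F :: "(real ^ 'd::finite) set" and x :: "int ^ 'd"
  assumes F: "bounded F" "negligible (frontier F)" "interior F \<noteq> {}" and \<epsilon>: "\<epsilon> > 0"
  shows "\<forall>\<^sub>F m in sequentially. \<forall>\<^sub>F r in at_top.
    real (card {y \<in> lattice_dilate F r.
            no_common_factor_in (primes_upto m) (x + y) \<and> \<not> cop (x + y)}) /
      card (lattice_dilate F r) \<le> \<epsilon>"
proof (cases "CARD('d) = 1")
  case True
  have "\<forall>\<^sub>F m in sequentially. (\<Prod>p\<in>primes_upto m. 1 - 1 / real p) < \<epsilon>"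
    using Euler_product_tendsto_0 \<epsilon> order_tendstoD(2) by blast
  then show ?thesis
  proof eventually_elim
    case (elim m)
    have "((\<lambda>r. (\<Sum>y\<in>lattice_dilate F r. of_bool (no_common_factor_in (primes_upto m) (x + y)))
          / card (lattice_dilate F r))
        \<longlongrightarrow> (\<Prod>p\<in>primes_upto m. 1 - 1 / real p)) at_top"
    proof -
      have density: "sieve_average (primes_upto m) (\<lambda>\<omega>. of_bool (\<omega> x))
          = (\<Prod>p\<in>primes_upto m. 1 - 1 / real p)"
        by (subst sieve_one_point_density) (auto simp: True)
      show ?thesis
        unfolding density[symmetric]
        by (rule truncated_average_converges[OF F, where h = "\<lambda>\<omega>. of_bool (\<omega> x)"]) auto
    qed
    from order_tendstoD(2)[OF this elim] eventually_gt_at_top[of 0]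
    show ?case
    proof eventually_elim
      case (elim r)
      have fin: "finite (lattice_dilate F r)" using finite_lattice_dilate[OF F(1) elim(2)] .
      have "real (card {y \<in> lattice_dilate F r.
            no_common_factor_in (primes_upto m) (x + y) \<and> \<not> cop (x + y)})
          \<le> real (card {y \<in> lattice_dilate F r.
            no_common_factor_in (primes_upto m) (x + y)})"
        using fin by (intro of_nat_mono card_mono) auto
      also have "\<dots> = (\<Sum>y\<in>lattice_dilate F r. of_bool (no_common_factor_in (primes_upto m) (x + y)))"
        using fin by (simp add: sum_of_bool_eq Int_def)
      finally have "real (card {y \<in> lattice_dilate F r.
            no_common_factor_in (primes_upto m) (x + y) \<and> \<not> cop (x + y)}) / card (lattice_dilate F r)
          \<le> (\<Sum>y\<in>lattice_dilate F r. of_bool (no_common_factor_in (primes_upto m) (x + y)))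
            / card (lattice_dilate F r)"
        by (rule divide_right_mono) simp
      then show ?case using elim(1) by linarith
    qed
  qed
next
  case False
  moreover have "CARD('d) > 0" by simp
  ultimately have "CARD('d) \<ge> 2" by linarith
  from card_large_common_divisor_le[OF F(1) this, of x]
  obtain K where K: "K > 0" "\<forall>m\<ge>1. \<forall>r\<ge>1.
      real (card {y \<in> lattice_dilate F r. x + y \<noteq> 0 \<and> (\<exists>p>m. \<forall>i. int p dvd (x + y) $ i)})
        \<le> K * r ^ CARD('d) / real m"
    by (elim exE conjE)
  define V where "V = measure lborel (interior F)"
  have V: "V > 0" unfolding V_def by (rule measure_interior_pos[OF F(1,3)])
  have "\<forall>\<^sub>F m in sequentially. m \<ge> max 2 (nat \<lceil>2 * K / (V * \<epsilon>)\<rceil>)" by (rule eventually_ge_at_top)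
  then show ?thesis
  proof eventually_elim
    case (elim m)
    then have m2: "m \<ge> 2" and "nat \<lceil>2 * K / (V * \<epsilon>)\<rceil> \<le> m" by auto
    then have "2 * K / (V * \<epsilon>) \<le> m" by linarith
    then have m: "2 * K / (V * m) \<le> \<epsilon>" using V \<epsilon> m2 by (simp add: field_simps)
    have "\<forall>\<^sub>F r in at_top. card (lattice_dilate F r) / r ^ CARD('d) > V / 2"
      using card_lattice_dilate_asymp[OF F(1,2)] V unfolding V_def by (intro order_tendstoD(1)) auto
    then show ?case using eventually_ge_at_top[of 1]
    proof eventually_elim
      case (elim r)
      have rpos: "r ^ CARD('d) > 0" using elim(2) by simp
      have fin: "finite (lattice_dilate F r)" using finite_lattice_dilate[OF F(1)] elim(2) by simp
      have card: "card (lattice_dilate F r) > V / 2 * r ^ CARD('d)" using elim(1) rpos by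
        (simp add: field_simps)
      have "{y \<in> lattice_dilate F r. no_common_factor_in (primes_upto m) (x + y) \<and> \<not> cop (x + y)}
          \<subseteq> {y \<in> lattice_dilate F r. x + y \<noteq> 0 \<and> (\<exists>p>m. \<forall>i. int p dvd (x + y) $ i)}" (is "?bad \<subseteq> ?big")
      proof safe
        fix y assume y: "no_common_factor_in (primes_upto m) (x + y)" "\<not> cop (x + y)"
        then obtain p where p: "prime p" "\<forall>i. int p dvd (x + y) $ i"
          unfolding cop_eq_no_common_prime by (auto simp: no_common_factor_in_def)
        then have "p \<notin> primes_upto m" using y(1) by (auto simp: no_common_factor_in_def)
        then show "\<exists>p>m. \<forall>i. int p dvd (x + y) $ i" using p by (intro exI[of _ p]) auto
        \<comment> \<open>The origin has arbitrarily large common divisors, but it is caught by the prime 2.\<close>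
        assume "x + y = 0"
        moreover have "2 \<in> primes_upto m" using m2 by simp
        ultimately show False using y(1) by (auto simp: no_common_factor_in_def)
      qed
      then have "real (card ?bad) \<le> real (card ?big)" using fin
        by (intro of_nat_mono card_mono) auto
      also have "\<dots> \<le> K * r ^ CARD('d) / m" using K(2) m2 elim(2) by simp
      finally have "real (card ?bad) / card (lattice_dilate F r)
          \<le> (K * r ^ CARD('d) / m) / (V / 2 * r ^ CARD('d))"
        using card K(1) V rpos by (intro frac_le) auto
      also have "\<dots> = 2 * K / (V * m)" using elim(2) by (simp add: field_simps)
      also have "\<dots> \<le> \<epsilon>" by (rule m)
      finally show ?case .
    qed
  qed
qed

section \<open>The limit measure as a limit of finite sieves\<close>

text \<open>
  Each point has a neighbourhood that is given by finitely many coordinates and on which \<open>f\<close> varies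
  little; by compactness finitely many of these neighbourhoods suffice, and all their coordinates
  together form \<open>S\<close>.
\<close>

lemma continuous_nearly_finitely_determined:
  fixes f :: "('a \<Rightarrow> 'b :: {discrete_topology, finite}) \<Rightarrow> 'c :: metric_space"
  assumes f: "continuous_on UNIV f" and "\<epsilon> > 0"
  obtains S where "finite S" "\<And>\<omega> \<omega>'. (\<And>x. x \<in> S \<Longrightarrow> \<omega> x = \<omega>' x) \<Longrightarrow> dist (f \<omega>) (f \<omega>') < \<epsilon>"
proof -
  have "\<exists>S. finite S \<and> (\<forall>\<omega>'. (\<forall>x\<in>S. \<omega>' x = \<omega> x) \<longrightarrow> dist (f \<omega>') (f \<omega>) < \<epsilon> / 2)" for \<omega>
  proof -
    have "open (f -` ball (f \<omega>) (\<epsilon> / 2))" using f by (simp add: open_vimage)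
    then have "openin (product_topology (\<lambda>i. euclidean) UNIV) (f -` ball (f \<omega>) (\<epsilon> / 2))"
      by (simp add: euclidean_product_topology)
    moreover have "\<omega> \<in> f -` ball (f \<omega>) (\<epsilon> / 2)" using assms(2) by simp
    ultimately obtain X where X: "\<omega> \<in> PiE UNIV X" "finite {i. X i \<noteq> UNIV}"
        "PiE UNIV X \<subseteq> f -` ball (f \<omega>) (\<epsilon> / 2)"
      using product_topology_open_contains_basis[of "\<lambda>_. euclidean" UNIV "f -` ball (f \<omega>) (\<epsilon> / 2)" \<omega>]
      by auto
    have "dist (f \<omega>') (f \<omega>) < \<epsilon> / 2" if *: "\<forall>x\<in>{i. X i \<noteq> UNIV}. \<omega>' x = \<omega> x" for \<omega>'
    proof -
      have "\<omega>' i \<in> X i" for i using X(1) * by (cases "X i = UNIV") (auto simp: PiE_iff)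
      then have "\<omega>' \<in> PiE UNIV X" by auto
      then show ?thesis using X(3) by (auto simp: dist_commute)
    qed
    then show ?thesis using X(2) by blast
  qed
  then obtain T where T: "\<And>\<omega>. finite (T \<omega>)"
    "\<And>\<omega> \<omega>'. (\<forall>x\<in>T \<omega>. \<omega>' x = \<omega> x) \<Longrightarrow> dist (f \<omega>') (f \<omega>) < \<epsilon> / 2" by metis
  define U where "U \<omega> = {\<omega>'. \<forall>x\<in>T \<omega>. \<omega>' x = \<omega> x}" for \<omega>
  have U: "open (U \<omega>)" for \<omega>
    unfolding U_def using product_topology_basis'[OF T(1)[of \<omega>], of "\<lambda>x. {\<omega> x}" "\<lambda>x. x"]
    by (simp add: discrete_topology_class.open_discrete)
  have "compact (UNIV :: ('a \<Rightarrow> 'b) set)"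
  proof -
    have "compact_space (euclidean :: 'b topology)"
      by (simp add: compact_space_def finite_imp_compact)
    then have "compact_space (product_topology (\<lambda>i::'a. euclidean :: 'b topology) UNIV)"
      by (simp add: compact_space_product_topology)
    then show ?thesis by (simp add: euclidean_product_topology compact_space_def)
  qed
  then obtain D where D: "finite D" "UNIV \<subseteq> (\<Union>\<omega>\<in>D. U \<omega>)"
  proof (rule compactE_image)
    show "UNIV \<subseteq> (\<Union>\<omega>\<in>UNIV. U \<omega>)" by (auto simp: U_def)
  qed (use U in auto)
  show thesis
  proof (rule that)
    show "finite (\<Union>\<omega>\<in>D. T \<omega>)" using D(1) T(1) by blast
    fix \<omega> \<omega>' :: "'a \<Rightarrow> 'b" assume *: "\<And>x. x \<in> (\<Union>\<omega>\<in>D. T \<omega>) \<Longrightarrow> \<omega> x = \<omega>' x"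
    obtain \<eta> where \<eta>: "\<eta> \<in> D" "\<omega> \<in> U \<eta>" using D(2) by blast
    have "dist (f \<omega>) (f \<eta>) < \<epsilon> / 2" using \<eta>(2) by (intro T(2)) (simp add: U_def)
    moreover have "dist (f \<omega>') (f \<eta>) < \<epsilon> / 2"
      using \<eta> * by (intro T(2)) (fastforce simp: U_def)
    ultimately show "dist (f \<omega>) (f \<omega>') < \<epsilon>"
      by (rule dist_triangle_half_l)
  qed
qed

lemma PiM_uniform_count_measure:
  assumes J: "finite J" and A: "\<And>j. j \<in> J \<Longrightarrow> finite (A j)" "\<And>j. j \<in> J \<Longrightarrow> A j \<noteq> {}"
  shows "PiM J (\<lambda>j. uniform_count_measure (A j)) = uniform_count_measure (PiE J A)"
proof (rule measure_eqI_finite)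
  \<comment> \<open>Outside \<open>J\<close> the factors are replaced by one-point spaces, as the product constructions ask
    for countable sets and probability spaces at all indices.\<close>
  let ?A = "\<lambda>j. if j \<in> J then A j else {undefined}"
  have fin: "finite (PiE J A)" using J A by (intro finite_PiE) auto
  then show "finite (PiE J A)" .
  have "PiM J (\<lambda>j. uniform_count_measure (A j)) = PiM J (\<lambda>j. uniform_count_measure (?A j))"
    by (intro PiM_cong) auto
  moreover have "sets (PiM J (\<lambda>j. uniform_count_measure (?A j))) = sets (PiM J (\<lambda>j. count_space (?A j)))"
    by (intro sets_PiM_cong) (auto simp: sets_uniform_count_measure)
  moreover have "PiM J (\<lambda>j. count_space (?A j)) = count_space (PiE J ?A)"
    using A by (intro count_space_PiM_finite J) (auto intro: countable_finite)
  moreover have "PiE J ?A = PiE J A" by (intro PiE_cong) auto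
  ultimately show sets: "sets (PiM J (\<lambda>j. uniform_count_measure (A j))) = Pow (PiE J A)" by simp
  show "sets (uniform_count_measure (PiE J A)) = Pow (PiE J A)" by
    (simp add: sets_uniform_count_measure)
  fix W assume W: "W \<in> PiE J A"
  interpret product_prob_space "\<lambda>j. uniform_count_measure (?A j)" J
    by (auto simp: product_prob_space_def product_prob_space_axioms_def product_sigma_finite_def
        intro!: prob_space_imp_sigma_finite Probability_Measure.prob_space_uniform_count_measure dest: A)
  have "emeasure (PiM J (\<lambda>j. uniform_count_measure (A j))) {W}
      = emeasure (PiM J (\<lambda>j. uniform_count_measure (?A j))) (PiE J (\<lambda>j. {W j}))"
    using W by (intro arg_cong2[where f = emeasure] PiM_cong) (auto simp: PiE_singleton PiE_iff)
  also have "\<dots> = (\<Prod>j\<in>J. emeasure (uniform_count_measure (?A j)) {W j})"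
    using J W by (intro emeasure_PiM) (auto simp: sets_uniform_count_measure)
  also have "\<dots> = (\<Prod>j\<in>J. ennreal (1 / card (A j)))"
    using A W by (intro prod.cong refl) (auto simp: emeasure_uniform_count_measure dest: PiE_mem)
  also have "\<dots> = ennreal (1 / card (PiE J A))"
    using J by (simp add: prod_ennreal card_PiE prod_dividef)
  also have "\<dots> = emeasure (uniform_count_measure (PiE J A)) {W}"
    using fin W by (simp add: emeasure_uniform_count_measure)
  finally show "emeasure (PiM J (\<lambda>j. uniform_count_measure (A j))) {W}
      = emeasure (uniform_count_measure (PiE J A)) {W}" .
qed

text \<open>
  The sieve by \<open>J\<close> factors through the restriction of \<open>W\<close> to \<open>J\<close>, whose law is uniform on a finite
  set.  This also makes every \<open>h\<close> measurable after composition.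
\<close>

lemma integral_truncated_sieve:
  fixes h :: "'d::finite config \<Rightarrow> real"
  assumes J: "finite J" "\<And>p. p \<in> J \<Longrightarrow> prime p"
  defines "M \<equiv> \<lambda>p. uniform_count_measure (lattice_cosets p :: (int ^ 'd) set set)"
  shows "(\<lambda>W. h (sieve J W)) \<in> borel_measurable (PiM {p. prime p} M)" (is ?meas)
    and "(\<integral>W. h (sieve J W) \<partial>PiM {p. prime p} M) = sieve_average J h" (is ?int)
proof -
  let ?C = "lattice_cosets :: nat \<Rightarrow> (int ^ 'd) set set"
  let ?P = "{p::nat. prime p}"
  have C: "finite (?C p)" "?C p \<noteq> {}" if "prime p" for p
    using that by (auto simp: finite_lattice_cosets prime_gt_0_nat lattice_cosets_nonempty)
  have PiM_J: "PiM J M = uniform_count_measure (PiE J ?C)"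
    unfolding M_def using J C by (intro PiM_uniform_count_measure) auto
  have restrict: "sieve J (restrict W J) = sieve J W" for W
    by (simp add: sieve_def)
  have meas_restrict: "(\<lambda>W. restrict W J) \<in> measurable (PiM ?P M) (PiM J M)"
    using J by (intro measurable_restrict_subset) auto
  have meas_J: "(\<lambda>W. h (sieve J W)) \<in> borel_measurable (PiM J M)"
    unfolding PiM_J by
      (simp add: measurable_cong_sets[OF sets_uniform_count_measure_count_space refl])
  show ?meas
    using measurable_compose[OF meas_restrict meas_J] by (simp add: restrict)
  \<comment> \<open>The locale of product probability spaces requires a probability space at every index, and
    the number 0 has infinitely many cosets.\<close>
  define M' where "M' p = (if prime p then M p else count_space {undefined})" for p
  interpret product_prob_space M' ?P
  proof -
    have "prob_space (M' p)" for p
    proof (cases "prime p")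
      case True
      then show ?thesis using C by
        (simp add: M'_def M_def Probability_Measure.prob_space_uniform_count_measure)
    qed (auto simp: M'_def intro!: prob_spaceI)
    then show "product_prob_space M'"
      by (simp add: product_prob_space_def product_prob_space_axioms_def product_sigma_finite_def
          prob_space_imp_sigma_finite)
  qed
  have eq: "PiM ?P M = PiM ?P M'" "PiM J M = PiM J M'"
    using J by (auto simp: M'_def intro!: PiM_cong)
  have "distr (PiM ?P M) (PiM J M) (\<lambda>W. restrict W J) = PiM J M"
    unfolding eq using J by (intro distr_PiM_restrict_finite) auto
  then have "(\<integral>W. h (sieve J W) \<partial>PiM J M) = (\<integral>W. h (sieve J W) \<partial>PiM ?P M)"
    using integral_distr[OF meas_restrict meas_J] by (simp add: restrict)
  then show ?int
    unfolding PiM_J sieve_average_def using J C by (subst (asm) integral_uniform_count_measure)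
      (auto intro!: finite_PiE)
qed

text \<open>
  For fixed \<open>W\<close> and \<open>x\<close> the truncated sieve is eventually constant in \<open>n\<close>, so the configurations
  converge coordinatewise and \<open>f\<close> converges along them.
\<close>

lemma sieve_truncation_converges:
  fixes f :: "'d::finite config \<Rightarrow> real"
  assumes f: "continuous_on UNIV f" and bound: "\<And>\<omega>. \<bar>f \<omega>\<bar> \<le> B"
  shows "(\<lambda>n. sieve_average (primes_upto n) f) \<longlonglongrightarrow> (\<integral>\<omega>. f \<omega> \<partial>cop_limit_measure)"
proof -
  define Q where "Q = (\<Pi>\<^sub>M p\<in>{p. prime p}. uniform_count_measure (lattice_cosets p :: (int ^ 'd) set set))"
  interpret prob_space Q
    unfolding Q_def
    by (intro prob_space_PiM Probability_Measure.prob_space_uniform_count_measure)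
      (auto simp: finite_lattice_cosets prime_gt_0_nat lattice_cosets_nonempty)
  have meas_f: "f \<in> borel_measurable borel" using f by (rule borel_measurable_continuous_onI)
  have meas: "sieve {p. prime p} \<in> measurable Q borel"
    unfolding Q_def sieve_def by (rule measurable_sieve)
  have "(\<integral>\<omega>. f \<omega> \<partial>cop_limit_measure) = (\<integral>W. f (sieve {p. prime p} W) \<partial>Q)"
    unfolding cop_limit_measure_def Q_def[symmetric] sieve_def[symmetric]
    by (rule integral_distr[OF meas meas_f])
  moreover have "(\<lambda>n. \<integral>W. f (sieve (primes_upto n) W) \<partial>Q) \<longlonglongrightarrow> (\<integral>W. f (sieve {p. prime p} W) \<partial>Q)"
  proof (rule integral_dominated_convergence[where w = "\<lambda>_. B"])
    show "(\<lambda>W. f (sieve {p. prime p} W)) \<in> borel_measurable Q"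
      using measurable_compose[OF meas meas_f] .
    show "(\<lambda>W. f (sieve (primes_upto n) W)) \<in> borel_measurable Q" for n
      unfolding Q_def by (rule integral_truncated_sieve) auto
    show "AE W in Q. (\<lambda>n. f (sieve (primes_upto n) W)) \<longlonglongrightarrow> f (sieve {p. prime p} W)"
    proof (intro always_eventually allI metric_LIMSEQ_I)
      fix W :: "nat \<Rightarrow> (int ^ 'd) set" and e :: real assume "e > 0"
      then obtain S where S: "finite S"
        "\<And>\<omega> \<omega>'. (\<And>x. x \<in> S \<Longrightarrow> \<omega> x = \<omega>' x) \<Longrightarrow> dist (f \<omega>) (f \<omega>') < e"
        using continuous_nearly_finitely_determined[OF f] by metis
      have "\<exists>n0. \<forall>n\<ge>n0. sieve (primes_upto n) W x = sieve {p. prime p} W x" for x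
      proof (cases "\<exists>p. prime p \<and> x \<in> W p")
        case True
        then obtain p where "prime p" "x \<in> W p" by blast
        then show ?thesis by (intro exI[of _ p]) (auto simp: sieve_def)
      qed (auto simp: sieve_def)
      then obtain n0 where n0: "\<And>x n. n \<ge> n0 x \<Longrightarrow> sieve (primes_upto n) W x = sieve {p. prime p} W x"
        by metis
      show "\<exists>n0. \<forall>n\<ge>n0. dist (f (sieve (primes_upto n) W)) (f (sieve {p. prime p} W)) < e"
      proof (intro exI[of _ "\<Sum>x\<in>S. n0 x"] allI impI S(2) n0)
        fix n x assume "n \<ge> (\<Sum>x\<in>S. n0 x)" "x \<in> S"
        then show "n \<ge> n0 x" using member_le_sum[of x S n0] S(1) by simp
      qed
    qed
  qed (use bound in auto)
  ultimately show ?thesis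
    unfolding Q_def by (subst (asm) integral_truncated_sieve(2)) auto
qed

section \<open>Weak convergence\<close>

theorem theorem2p1:
  fixes F :: "(real ^ 'd::finite) set"
  assumes "bounded F"
    and "convex F"
    and "interior F \<noteq> {}"
  shows "converges_weakly (\<lambda>r. shift_measure (lattice_dilate F r) cop) cop_limit_measure at_top"
  unfolding converges_weakly_def
proof (intro allI impI)
  fix f :: "'d config \<Rightarrow> real"
  assume f: "continuous_on UNIV f" and "bounded (range f)"
  then obtain B where B: "B > 0" "\<And>\<omega>. \<bar>f \<omega>\<bar> \<le> B" by (auto simp: bounded_pos)
  have F: "bounded F" "negligible (frontier F)" "interior F \<noteq> {}"
    using assms by (auto intro: negligible_convex_frontier)
  let ?L = "lattice_dilate F"
  define A where "A r = (\<Sum>y\<in>?L r. f (\<lambda>x. cop (x + y))) / card (?L r)" for r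
  define A' where
    "A' m r = (\<Sum>y\<in>?L r. f (\<lambda>x. no_common_factor_in (primes_upto m) (x + y))) / card (?L r)" for m r
  define l where "l = (\<integral>\<omega>. f \<omega> \<partial>cop_limit_measure)"
  define l' where "l' m = sieve_average (primes_upto m) f" for m
  have shift: "(\<integral>\<omega>. f \<omega> \<partial>shift_measure (?L r) cop) = A r" if "r > 0" for r
  proof -
    have "(\<integral>\<omega>. f \<omega> \<partial>shift_measure (?L r) cop)
        = (\<integral>y. f (\<lambda>x. cop (x + y)) \<partial>uniform_count_measure (?L r))"
      unfolding shift_measure_def using borel_measurable_continuous_onI[OF f]
      by (intro integral_distr)
        (simp add: measurable_cong_sets[OF sets_uniform_count_measure_count_space refl])
    then show ?thesis
      using finite_lattice_dilate[OF F(1) that] by (simp add: integral_uniform_count_measure A_def)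
  qed
  have "(A \<longlongrightarrow> l) at_top"
  proof (rule tendstoI)
    fix e :: real assume e: "e > 0"
    then have "e / 4 > 0" by simp
    then obtain S where S: "finite S"
      "\<And>\<omega> \<omega>'. (\<And>x. x \<in> S \<Longrightarrow> \<omega> x = \<omega>' x) \<Longrightarrow> dist (f \<omega>) (f \<omega>') < e / 4"
      using continuous_nearly_finitely_determined[OF f] by metis
    define bad where
      "bad m r x = {y \<in> ?L r. no_common_factor_in (primes_upto m) (x + y) \<and> \<not> cop (x + y)}"
        for m r x
    \<comment> \<open>Chosen so that \<open>2 * B * card S * \<delta> \<le> e / 4\<close>; the summand 1 covers the case of empty \<open>S\<close>.\<close>
    define \<delta> where "\<delta> = e / (8 * B * (real (card S) + 1))"
    have \<delta>: "\<delta> > 0" using e B(1) by (simp add: \<delta>_def)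
    have approx: "\<bar>A r - A' m r\<bar> \<le> e / 4 + 2 * B * (\<Sum>x\<in>S. card (bad m r x) / card (?L r))"
      if r: "r > 0" for m r
    proof -
      have fin: "finite (?L r)" using finite_lattice_dilate[OF F(1) r] .
      \<comment> \<open>Unless truncation is wrong somewhere on \<open>S\<close>, the two configurations agree there.\<close>
      have pointwise: "\<bar>f (\<lambda>x. cop (x + y)) - f (\<lambda>x. no_common_factor_in (primes_upto m) (x + y))\<bar>
          \<le> e / 4 + 2 * B * (\<Sum>x\<in>S. of_bool (y \<in> bad m r x))"
        (is "\<bar>f ?\<omega> - f ?\<omega>'\<bar> \<le> _") if y: "y \<in> ?L r" for y
      proof (cases "\<exists>x\<in>S. y \<in> bad m r x")
        case True
        then obtain x where "x \<in> S" "y \<in> bad m r x" by blast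
        then have "1 \<le> (\<Sum>x\<in>S. of_bool (y \<in> bad m r x) :: real)"
          using member_le_sum[of x S "\<lambda>x. of_bool (y \<in> bad m r x) :: real"] S(1) by simp
        then have "2 * B * 1 \<le> 2 * B * (\<Sum>x\<in>S. of_bool (y \<in> bad m r x))"
          using B(1) by (intro mult_left_mono) auto
        moreover have "\<bar>f ?\<omega> - f ?\<omega>'\<bar> \<le> 2 * B" using B(2)[of ?\<omega>] B(2)[of ?\<omega>'] by linarith
        ultimately show ?thesis using e by linarith
      next
        case False
        have "cop (x + y) \<longleftrightarrow> no_common_factor_in (primes_upto m) (x + y)" if "x \<in> S" for x
        proof
          show "no_common_factor_in (primes_upto m) (x + y)" if "cop (x + y)"
            using that by (simp add: cop_eq_no_common_prime no_common_factor_in_def)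
          show "cop (x + y)" if "no_common_factor_in (primes_upto m) (x + y)"
            using False \<open>x \<in> S\<close> y that by (auto simp: bad_def)
        qed
        then have "dist (f ?\<omega>) (f ?\<omega>') < e / 4" by (rule S(2))
        then have "\<bar>f ?\<omega> - f ?\<omega>'\<bar> \<le> e / 4" by (simp add: dist_real_def)
        moreover have "0 \<le> 2 * B * (\<Sum>x\<in>S. of_bool (y \<in> bad m r x))"
          using B(1) by (simp add: sum_nonneg)
        ultimately show ?thesis by linarith
      qed
      have "\<bar>A r - A' m r\<bar>
          = \<bar>\<Sum>y\<in>?L r. f (\<lambda>x. cop (x + y)) - f (\<lambda>x. no_common_factor_in (primes_upto m) (x + y))\<bar>
          / card (?L r)"
        by (simp add: A_def A'_def sum_subtractf flip: diff_divide_distrib)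
      also have "\<dots> \<le> (\<Sum>y\<in>?L r. e / 4 + 2 * B * (\<Sum>x\<in>S. of_bool (y \<in> bad m r x))) / card (?L r)"
        using pointwise by (intro divide_right_mono order_trans[OF sum_abs] sum_mono) auto
      also have "(\<Sum>y\<in>?L r. e / 4 + 2 * B * (\<Sum>x\<in>S. of_bool (y \<in> bad m r x)))
          = card (?L r) * (e / 4) + 2 * B * (\<Sum>x\<in>S. \<Sum>y\<in>?L r. of_bool (y \<in> bad m r x))"
        by (simp add: sum.distrib sum_distrib_left sum.swap[of _ "?L r"])
      also have "(\<Sum>x\<in>S. \<Sum>y\<in>?L r. of_bool (y \<in> bad m r x)) = (\<Sum>x\<in>S. real (card (bad m r x)))"
        using fin by (intro sum.cong refl)
          (auto simp: sum_of_bool_eq bad_def intro!: arg_cong[of _ _ card])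
      also have "(card (?L r) * (e / 4) + 2 * B * (\<Sum>x\<in>S. real (card (bad m r x)))) / card (?L r)
          = card (?L r) * (e / 4) / card (?L r) + 2 * B * (\<Sum>x\<in>S. card (bad m r x) / card (?L r))"
        by (simp only: add_divide_distrib sum_divide_distrib[symmetric] times_divide_eq_right)
      also have "card (?L r) * (e / 4) / card (?L r) \<le> e / 4" using e by simp
      finally show ?thesis by simp
    qed
    have "\<forall>\<^sub>F m in sequentially. \<forall>x\<in>S. \<forall>\<^sub>F r in at_top. card (bad m r x) / card (?L r) \<le> \<delta>"
      unfolding bad_def using S(1) truncation_error_small[OF F \<delta>]
      by (intro eventually_ball_finite) auto
    moreover have "\<forall>\<^sub>F m in sequentially. dist (l' m) l < e / 4"
      unfolding l_def l'_def using e sieve_truncation_converges[OF f B(2)] by (intro tendstoD) auto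
    ultimately have "\<forall>\<^sub>F m in sequentially.
        (\<forall>x\<in>S. \<forall>\<^sub>F r in at_top. card (bad m r x) / card (?L r) \<le> \<delta>) \<and> dist (l' m) l < e / 4"
      by (rule eventually_conj)
    then obtain m where m: "\<forall>x\<in>S. \<forall>\<^sub>F r in at_top. card (bad m r x) / card (?L r) \<le> \<delta>"
        "dist (l' m) l < e / 4"
      by (auto simp: eventually_sequentially)
    have "\<forall>\<^sub>F r in at_top. \<forall>x\<in>S. card (bad m r x) / card (?L r) \<le> \<delta>"
      using S(1) m(1) by (intro eventually_ball_finite) auto
    moreover have "\<forall>\<^sub>F r in at_top. dist (A' m r) (l' m) < e / 4"
      unfolding A'_def l'_def using e by (intro tendstoD truncated_average_converges F) auto
    ultimately show "\<forall>\<^sub>F r in at_top. dist (A r) l < e"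
      using eventually_gt_at_top[of 0]
    proof eventually_elim
      case (elim r)
      have "(\<Sum>x\<in>S. card (bad m r x) / card (?L r)) \<le> card S * \<delta>"
        using elim(1) by (intro sum_bounded_above) auto
      then have "2 * B * (\<Sum>x\<in>S. card (bad m r x) / card (?L r)) \<le> 2 * B * (card S * \<delta>)"
        using B(1) by (intro mult_left_mono) auto
      also have "\<dots> \<le> 2 * B * ((real (card S) + 1) * \<delta>)" using B(1) \<delta> by (simp add: mult_right_mono)
      also have "\<dots> = e / 4"
      proof -
        have "2 * B * (s * (e / (8 * B * s))) = e / 4" if "s > 0" for s
          using that B(1) by (simp add: field_simps)
        then show ?thesis unfolding \<delta>_def by (meson add_nonneg_pos of_nat_0_le_iff zero_less_one)
      qed
      finally have "\<bar>A r - A' m r\<bar> \<le> e / 4 + e / 4" using approx[OF elim(3), of m] by linarith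
      then show ?case using elim(2) m(2) unfolding dist_real_def by linarith
    qed
  qed
  then show "((\<lambda>r. \<integral>\<omega>. f \<omega> \<partial>shift_measure (?L r) cop) \<longlongrightarrow> (\<integral>\<omega>. f \<omega> \<partial>cop_limit_measure)) at_top"
    unfolding l_def by (rule Lim_transform_eventually)
      (use shift in \<open>auto intro!: eventually_mono[OF eventually_gt_at_top[of 0]]\<close>)
qed

end
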